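(* Let $T \in \mathcal{AM}(H)$ be hyponormal. Then there exist subspaces $H_0, H_1, H_2$ with $\dim(H_0) < \infty$ such that $H = H_0 \oplus H_1 \oplus H_2$ and, with respect to this decomposition, $$T = \begin{pmatrix} V_0 & 0 & 0 \\ 0 & \beta V_1 & A \\ 0 & 0 & B \end{pmatrix},$$ where $\sigma_{ess}(|T|) = \{\beta\}$, $\beta \geq 0$, and (i) $V_0 = \bigoplus_{i=1}^{n} \alpha_i U_i$ is a finite rank normal operator such that $U_i$ is unitary on $N(|T| - \alpha_i I)$, where $(\beta, \|T\|] \cap \sigma(|T|) = \{\alpha_i\}_{i=1}^{n}$, $n \in \mathbb{N}$; if $\beta = \|T\|$, then $H_0 = \{0\}$; (ii) $V_1$ is an isometry on $H_1$ if $H_1 \neq \{0\}$, otherwise $V_1 = 0$; (iii) $A \in \mathcal{B}(H_2, H_1)$ and $B \in \mathcal{B}(H_2)$ satisfy $V_1^* A = 0$, $A^*A + B^*B = \bigoplus_{j=1}^{m} \beta_j^2 I_{N(|T| - \beta_j I)}$ and $BB^* \leq \bigoplus_{j=1}^{m} \beta_j^2 I_{N(|T| - \beta_j I)}$, where $[m(T), \beta) \cap \sigma(|T|) = \{\beta_j\}_{j=1}^{m}$ for some $m \in \mathbb{N} \cup \{\infty\}$; if $\beta = m(T)$, then $H_2 = \{0\}$; and $T = \|T\| V_1$ if $\|T\| = \beta = m(T)$.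
   Context: $H$ is an infinite-dimensional complex Hilbert space; $\mathcal{B}(H_1,H_2)$ denotes the bounded linear operators from $H_1$ to $H_2$, $\mathcal{B}(H) = \mathcal{B}(H,H)$. $N(\cdot)$ denotes the null space, $\sigma(\cdot)$ the spectrum, $|T| = (T^*T)^{1/2}$, $I_E$ the identity on $E$. For self-adjoint $X, Y$, $X \le Y$ means $Y - X$ is positive. The minimum modulus of a bounded operator $S$ on a nonzero Hilbert space is $m(S) = \inf\{\|Sx\| : \|x\| = 1\}$; $S$ is minimum attaining if $\|Sx\| = m(S)$ for some unit vector $x$. $T \in \mathcal{AM}(H)$ means $T|_M : M \to H$ is minimum attaining for every nonzero closed subspace $M$ of $H$. $T$ is hyponormal if $T^*T - TT^* \geq 0$. $T$ is Fredholm if $R(T)$ is closed and $N(T)$, $N(T^* )$ are finite dimensional; $\sigma_{ess}(T) = \{\lambda \in \mathbb{C} : T - \lambda I \text{ is not Fredholm}\}$. Subspaces are closed and $\oplus$ is the orthogonal direct sum. The direct sum operators $\bigoplus_i \alpha_i U_i$ and $\bigoplus_j \beta_j^2 I_{N(|T|-\beta_j I)}$ act on $H_0 = \bigoplus_i N(|T|-\alpha_i I)$ and $H_2 = \bigoplus_j N(|T|-\beta_j I)$ respectively. The $\alpha_i$ are distinct and the $\beta_j$ are distinct; either family may be empty ($n=0$ or $m=0$), in which case the corresponding subspace is $\{0\}$ and the corresponding blocks are absent. *)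

theory Defs
  imports "HOL-Analysis.Analysis"
begin

section \<open>Complex Hilbert spaces\<close>

text \<open>The inner product is linear in its first argument.  The last axiom gives positivity and
  definiteness, since the norm is already one on the underlying real vector space.\<close>

class complex_inner = real_normed_vector +
  fixes scaleC :: "complex \<Rightarrow> 'a \<Rightarrow> 'a" (infixr \<open>*\<^sub>C\<close> 75)
    and cinner :: "'a \<Rightarrow> 'a \<Rightarrow> complex"
  assumes scaleC_add_right: "a *\<^sub>C (x + y) = a *\<^sub>C x + a *\<^sub>C y"
    and scaleC_add_left: "(a + b) *\<^sub>C x = a *\<^sub>C x + b *\<^sub>C x"
    and scaleC_scaleC: "a *\<^sub>C b *\<^sub>C x = (a * b) *\<^sub>C x"
    and scaleC_one: "1 *\<^sub>C x = x"
    and scaleC_of_real: "complex_of_real r *\<^sub>C x = r *\<^sub>R x"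
    and cinner_commute: "cinner x y = cnj (cinner y x)"
    and cinner_add_left: "cinner (x + y) z = cinner x z + cinner y z"
    and cinner_scaleC_left: "cinner (a *\<^sub>C x) y = a * cinner x y"
    and cinner_self: "cinner x x = complex_of_real ((norm x)\<^sup>2)"

class chilbert_space = complex_inner + complete_space

instantiation complex :: chilbert_space
begin

definition scaleC_complex :: "complex \<Rightarrow> complex \<Rightarrow> complex" where
  "scaleC_complex a x = a * x"

definition cinner_complex :: "complex \<Rightarrow> complex \<Rightarrow> complex" where
  "cinner_complex x y = x * cnj y"

instance
proof
  fix x :: complex
  show "cinner x x = complex_of_real ((norm x)\<^sup>2)"
    unfolding cinner_complex_def by (rule complex_norm_square [symmetric])
qed (simp_all add: scaleC_complex_def cinner_complex_def ring_distribs scaleR_conv_of_real)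

end

global_interpretation complex_vector:
  vector_space "scaleC :: complex \<Rightarrow> 'a \<Rightarrow> 'a::complex_inner"
  by standard (simp_all add: scaleC_add_right scaleC_add_left scaleC_scaleC scaleC_one)

definition cfinite_dim :: "'a::complex_inner set \<Rightarrow> bool" where
  "cfinite_dim S \<longleftrightarrow> (\<exists>B. finite B \<and> S \<subseteq> complex_vector.span B)"

definition closed_csubspace :: "'a::complex_inner set \<Rightarrow> bool" where
  "closed_csubspace S \<longleftrightarrow> complex_vector.subspace S \<and> closed S"

definition corthogonal :: "'a::complex_inner set \<Rightarrow> 'a set \<Rightarrow> bool" where
  "corthogonal S R \<longleftrightarrow> (\<forall>x\<in>S. \<forall>y\<in>R. cinner x y = 0)"

section \<open>Orthogonal direct sums\<close>

definition orthogonal_family :: "'i set \<Rightarrow> ('i \<Rightarrow> 'a::complex_inner set) \<Rightarrow> bool" where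
  "orthogonal_family I M \<longleftrightarrow>
     (\<forall>i\<in>I. closed_csubspace (M i)) \<and> (\<forall>i\<in>I. \<forall>j\<in>I. i \<noteq> j \<longrightarrow> corthogonal (M i) (M j))"

text \<open>The internal Hilbert direct sum of an orthogonal family of subspaces; it is \<open>{0}\<close> for the
  empty family.\<close>

definition hilbert_sum :: "'i set \<Rightarrow> ('i \<Rightarrow> 'a::complex_inner set) \<Rightarrow> 'a set" where
  "hilbert_sum I M = {x. \<exists>f. (\<forall>i\<in>I. f i \<in> M i) \<and> (f has_sum x) I}"

definition direct_sum_op ::
    "'i set \<Rightarrow> ('i \<Rightarrow> 'a::complex_inner set) \<Rightarrow> ('i \<Rightarrow> 'a \<Rightarrow> 'a) \<Rightarrow> 'a \<Rightarrow> 'a" where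
  "direct_sum_op I M S x =
     (THE y. \<exists>f. (\<forall>i\<in>I. f i \<in> M i) \<and> (f has_sum x) I \<and> ((\<lambda>i. S i (f i)) has_sum y) I)"

section \<open>Bounded operators between subspaces\<close>

text \<open>An operator from a closed subspace \<open>S\<close> to a closed subspace \<open>R\<close> is represented by a
  function on the ambient space of which only the values on \<open>S\<close> matter.  All notions take the
  subspaces as arguments; operators on the whole space use \<open>UNIV\<close>.\<close>

definition bounded_ops :: "'a::complex_inner set \<Rightarrow> 'a set \<Rightarrow> ('a \<Rightarrow> 'a) set" where
  "bounded_ops S R = {f. (\<forall>x\<in>S. f x \<in> R) \<and>
     (\<forall>x\<in>S. \<forall>y\<in>S. f (x + y) = f x + f y) \<and> (\<forall>c. \<forall>x\<in>S. f (c *\<^sub>C x) = c *\<^sub>C f x) \<and>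
     (\<exists>K. \<forall>x\<in>S. norm (f x) \<le> K * norm x)}"

definition adj_on :: "'a::complex_inner set \<Rightarrow> 'a set \<Rightarrow> ('a \<Rightarrow> 'a) \<Rightarrow> 'a \<Rightarrow> 'a" where
  "adj_on S R f y =
     (if y \<in> R then THE z. z \<in> S \<and> (\<forall>x\<in>S. cinner (f x) y = cinner x z) else 0)"

abbreviation adj :: "('a::complex_inner \<Rightarrow> 'a) \<Rightarrow> 'a \<Rightarrow> 'a" where
  "adj \<equiv> adj_on UNIV UNIV"

definition positive_on :: "'a::complex_inner set \<Rightarrow> ('a \<Rightarrow> 'a) \<Rightarrow> bool" where
  "positive_on S P \<longleftrightarrow> (\<forall>x\<in>S. cinner (P x) x \<in> \<real>\<^sub>\<ge>\<^sub>0)"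

definition op_le_on :: "'a::complex_inner set \<Rightarrow> ('a \<Rightarrow> 'a) \<Rightarrow> ('a \<Rightarrow> 'a) \<Rightarrow> bool" where
  "op_le_on S X Y \<longleftrightarrow> positive_on S (\<lambda>x. Y x - X x)"

definition isometry_on :: "'a::complex_inner set \<Rightarrow> ('a \<Rightarrow> 'a) \<Rightarrow> bool" where
  "isometry_on S V \<longleftrightarrow> V \<in> bounded_ops S S \<and> (\<forall>x\<in>S. norm (V x) = norm x)"

definition unitary_on :: "'a::complex_inner set \<Rightarrow> ('a \<Rightarrow> 'a) \<Rightarrow> bool" where
  "unitary_on S U \<longleftrightarrow> U \<in> bounded_ops S S \<and>
     (\<forall>x\<in>S. adj_on S S U (U x) = x \<and> U (adj_on S S U x) = x)"

definition normal_on :: "'a::complex_inner set \<Rightarrow> ('a \<Rightarrow> 'a) \<Rightarrow> bool" where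
  "normal_on S V \<longleftrightarrow> V \<in> bounded_ops S S \<and>
     (\<forall>x\<in>S. adj_on S S V (V x) = V (adj_on S S V x))"

section \<open>Operators on the whole space\<close>

definition null_space :: "('a::complex_inner \<Rightarrow> 'a) \<Rightarrow> 'a set" where
  "null_space S = {x. S x = 0}"

definition op_shift :: "('a::complex_inner \<Rightarrow> 'a) \<Rightarrow> complex \<Rightarrow> 'a \<Rightarrow> 'a" where
  "op_shift S c x = S x - c *\<^sub>C x"

definition op_sqrt :: "('a::complex_inner \<Rightarrow> 'a) \<Rightarrow> 'a \<Rightarrow> 'a" where
  "op_sqrt Q = (THE P. P \<in> bounded_ops UNIV UNIV \<and> positive_on UNIV P \<and> P \<circ> P = Q)"

definition abs_op :: "('a::complex_inner \<Rightarrow> 'a) \<Rightarrow> 'a \<Rightarrow> 'a" where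
  "abs_op T = op_sqrt (adj T \<circ> T)"

definition op_spectrum :: "('a::complex_inner \<Rightarrow> 'a) \<Rightarrow> complex set" where
  "op_spectrum S = {c. \<not> (\<exists>R \<in> bounded_ops UNIV UNIV.
     R \<circ> op_shift S c = id \<and> op_shift S c \<circ> R = id)}"

definition fredholm :: "('a::complex_inner \<Rightarrow> 'a) \<Rightarrow> bool" where
  "fredholm S \<longleftrightarrow> closed (range S) \<and> cfinite_dim (null_space S) \<and> cfinite_dim (null_space (adj S))"

definition ess_spectrum :: "('a::complex_inner \<Rightarrow> 'a) \<Rightarrow> complex set" where
  "ess_spectrum S = {c. \<not> fredholm (op_shift S c)}"

definition hyponormal :: "('a::complex_inner \<Rightarrow> 'a) \<Rightarrow> bool" where
  "hyponormal T \<longleftrightarrow> positive_on UNIV (\<lambda>x. adj T (T x) - T (adj T x))"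

text \<open>Minimum modulus of the restriction to a subspace \<open>M\<close>, meant for \<open>M \<noteq> {0}\<close>.\<close>

definition min_modulus :: "'a::complex_inner set \<Rightarrow> ('a \<Rightarrow> 'a) \<Rightarrow> real" where
  "min_modulus M S = Inf {norm (S x) | x. x \<in> M \<and> norm x = 1}"

definition min_attaining :: "'a::complex_inner set \<Rightarrow> ('a \<Rightarrow> 'a) \<Rightarrow> bool" where
  "min_attaining M S \<longleftrightarrow> (\<exists>x\<in>M. norm x = 1 \<and> norm (S x) = min_modulus M S)"

definition AM_op :: "('a::complex_inner \<Rightarrow> 'a) \<Rightarrow> bool" where
  "AM_op T \<longleftrightarrow> T \<in> bounded_ops UNIV UNIV \<and>
     (\<forall>M. closed_csubspace M \<and> M \<noteq> {0} \<longrightarrow> min_attaining M T)"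

definition abs_eigenspace :: "('a::complex_inner \<Rightarrow> 'a) \<Rightarrow> real \<Rightarrow> 'a set" where
  "abs_eigenspace T a = null_space (op_shift (abs_op T) (complex_of_real a))"

end

theory Submission
  imports Defs
begin

text \<open>Minimum attainment on the closed subspaces \<open>M\<close> orthogonal to all eigenvectors found so far yields
  a new eigenvector of \<open>T\<^sup>*T\<close>, so \<open>H\<close> has an orthonormal basis \<open>B\<close> of eigenvectors; let \<open>\<mu> b\<close> be the
  eigenvalue of \<open>|T|\<close> at \<open>b\<close>.  Minimum attainment also excludes orthonormal sequences on which the
  form \<open>\<parallel>T x\<parallel>\<^sup>2\<close> is diagonal with strictly decreasing entries.  Taking \<open>\<beta>\<^sup>2\<close> to be the infimum of all
  \<open>t\<close> with \<open>(\<mu> b)\<^sup>2 < t\<close> for infinitely many \<open>b\<close>, only finitely many eigenvalues, with multiplicity, lie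
  above \<open>\<beta>\<close> or below any \<open>t < \<beta>\<close>.  Everything about \<open>|T|\<close> (existence and uniqueness of the
  square root, spectrum, essential spectrum) is then read off in the basis \<open>B\<close>.  Finally, hyponormality
  gives \<open>\<parallel>T\<^sup>* y\<parallel> \<le> \<parallel>T y\<parallel>\<close>; applied to \<open>y = T x\<close> with \<open>x\<close> in the top eigenspace of \<open>|T|\<close> it forces \<open>y\<close>
  into that eigenspace, which reduces \<open>T\<close> when it is finite-dimensional, and one descends to \<open>\<beta>\<close>.\<close>

section \<open>Inner product calculus\<close>

text \<open>Minimum attainment is one-sided. Strictly decreasing diagonal values violate it, whereas
  an increasing sequence attains its minimum at the first term. Hence the asymmetry of the result:
  finitely many \<open>\<alpha> i\<close> lie above \<open>\<beta>\<close>, but infinitely many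
  \<open>b j\<close> may lie below it and accumulate at \<open>\<beta>\<close>. Finiteness above
  \<open>\<beta>\<close> also makes the upper eigenspaces reducing. There \<open>T\<close> is a
  multiple of an isometry of a finite-dimensional space into itself, so it is onto, and this is what
  keeps \<open>adj T\<close> inside the eigenspace. At \<open>\<beta>\<close> the eigenspace can be
  infinite-dimensional and the counting argument stops: only invariance under \<open>T\<close>
  survives. The isometry \<open>V1\<close> need therefore not be unitary, and a coupling
  \<open>A\<close> from \<open>H2\<close> to \<open>H1\<close> can remain. For any t below
  \<open>\<beta>\<close> infinitely many basis vectors have eigenvalue above t, so the descent ends
  at \<open>\<beta>\<close>.\<close>

instance chilbert_space \<subseteq> banach ..

lemma cinner_add_right: "cinner x (y + z) = cinner x y + cinner x (z :: 'a::complex_inner)"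
  by (metis cinner_add_left cinner_commute complex_cnj_add)

lemma cinner_scaleC_right: "cinner x (a *\<^sub>C y) = cnj a * cinner x (y :: 'a::complex_inner)"
  by (metis cinner_commute cinner_scaleC_left complex_cnj_mult)

lemma cinner_scaleR_left: "cinner (r *\<^sub>R x) y = complex_of_real r * cinner x (y :: 'a::complex_inner)"
  by (metis cinner_scaleC_left scaleC_of_real)

lemma cinner_scaleR_right: "cinner x (r *\<^sub>R y) = complex_of_real r * cinner x (y :: 'a::complex_inner)"
  by (metis cinner_scaleC_right complex_cnj_complex_of_real scaleC_of_real)

lemma cinner_zero_left [simp]: "cinner 0 (y :: 'a::complex_inner) = 0"
  using cinner_scaleR_left[of 0 0 y] by simp

lemma cinner_zero_right [simp]: "cinner (y :: 'a::complex_inner) 0 = 0"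
  using cinner_scaleR_right[of y 0 0] by simp

lemma cinner_minus_left: "cinner (- x) y = - cinner x (y :: 'a::complex_inner)"
  using cinner_scaleR_left[of "-1" x y] by simp

lemma cinner_minus_right: "cinner x (- y) = - cinner x (y :: 'a::complex_inner)"
  using cinner_scaleR_right[of x "-1" y] by simp

lemma cinner_diff_left: "cinner (x - y) z = cinner x z - cinner y (z :: 'a::complex_inner)"
  using cinner_add_left[of x "-y" z] by (simp add: cinner_minus_left)

lemma cinner_diff_right: "cinner x (y - z) = cinner x y - cinner x (z :: 'a::complex_inner)"
  using cinner_add_right[of x y "-z"] by (simp add: cinner_minus_right)

lemmas cinner_simps = cinner_add_left cinner_add_right cinner_scaleC_left cinner_scaleC_right
  cinner_scaleR_left cinner_scaleR_right cinner_minus_left cinner_minus_right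
  cinner_diff_left cinner_diff_right

lemma cinner_eq_0_commute: "cinner x y = 0 \<longleftrightarrow> cinner y (x :: 'a::complex_inner) = 0"
  by (metis cinner_commute complex_cnj_zero_iff)

lemma cinner_self_eq_0 [simp]: "cinner x x = 0 \<longleftrightarrow> (x :: 'a::complex_inner) = 0"
  by (simp add: cinner_self)

lemma norm_scaleC [simp]: "norm (a *\<^sub>C x) = cmod a * norm (x :: 'a::complex_inner)"
proof -
  have "complex_of_real ((norm (a *\<^sub>C x))\<^sup>2) = (a * cnj a) * complex_of_real ((norm x)\<^sup>2)"
    by (simp only: cinner_self[symmetric] cinner_scaleC_left cinner_scaleC_right ac_simps)
  also have "\<dots> = complex_of_real ((cmod a * norm x)\<^sup>2)"
    by (simp only: complex_norm_square[symmetric] of_real_mult[symmetric] power_mult_distrib)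
  finally have "(norm (a *\<^sub>C x))\<^sup>2 = (cmod a * norm x)\<^sup>2"
    using of_real_eq_iff by blast
  then show ?thesis
    by simp
qed

lemma complex_Cauchy_Schwarz: "cmod (cinner x y) \<le> norm x * norm (y :: 'a::complex_inner)"
proof (cases "y = 0")
  case False
  define n where "n = (norm y)\<^sup>2"
  define a where "a = cinner x y"
  \<comment> \<open>The component of \<open>x\<close> orthogonal to \<open>y\<close>, multiplied by
    the square of \<open>norm y\<close> to avoid a division.\<close>
  define z where "z = n *\<^sub>R x - a *\<^sub>C y"
  have n: "n > 0" using False by (simp add: n_def)
  have yy: "cinner y y = complex_of_real n" and yx: "cinner y x = cnj a"
    by (simp_all add: n_def cinner_self a_def cinner_commute[of y x])
  have "complex_of_real ((norm z)\<^sup>2) =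
      complex_of_real n * complex_of_real n * cinner x x - complex_of_real n * (a * cnj a)"
    unfolding cinner_self[symmetric] z_def cinner_simps yy yx a_def[symmetric]
    by (simp add: algebra_simps)
  also have "\<dots> = complex_of_real (n * n * (norm x)\<^sup>2 - n * (cmod a)\<^sup>2)"
    by (simp only: complex_norm_square[symmetric] of_real_mult[symmetric] cinner_self
        of_real_diff[symmetric])
  finally have "(norm z)\<^sup>2 = n * n * (norm x)\<^sup>2 - n * (cmod a)\<^sup>2"
    using of_real_eq_iff by blast
  then have "n * (cmod a)\<^sup>2 \<le> n * n * (norm x)\<^sup>2"
    using zero_le_power2[of "norm z"] by linarith
  also have "\<dots> = n * (norm x * norm y)\<^sup>2"
    by (simp add: n_def power_mult_distrib)
  finally have "(cmod a)\<^sup>2 \<le> (norm x * norm y)\<^sup>2"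
    using n by simp
  then show ?thesis
    unfolding a_def by (rule power2_le_imp_le) simp
qed simp

lemma bounded_bilinear_cinner: "bounded_bilinear (cinner :: 'a::complex_inner \<Rightarrow> 'a \<Rightarrow> complex)"
proof
  show "\<exists>K. \<forall>a b :: 'a. cmod (cinner a b) \<le> norm a * norm b * K"
    by (intro exI[of _ 1] allI) (simp add: complex_Cauchy_Schwarz)
qed (simp_all add: cinner_simps scaleR_conv_of_real)

lemmas bounded_linear_cinner_left = bounded_bilinear.bounded_linear_left[OF bounded_bilinear_cinner]
lemmas bounded_linear_cinner_right = bounded_bilinear.bounded_linear_right[OF bounded_bilinear_cinner]
lemmas cinner_sum_left = bounded_bilinear.sum_left[OF bounded_bilinear_cinner]
lemmas cinner_sum_right = bounded_bilinear.sum_right[OF bounded_bilinear_cinner]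
lemmas has_sum_cinner_left = has_sum_bounded_linear[OF bounded_linear_cinner_left]
lemmas has_sum_cinner_right = has_sum_bounded_linear[OF bounded_linear_cinner_right]

lemma cinner_self_real: "Im (cinner x (x :: 'a::complex_inner)) = 0" "Re (cinner x x) = (norm x)\<^sup>2"
  by (simp_all add: cinner_self del: of_real_power)

text \<open>Cauchy-Schwarz for a Hermitian form that is only semidefinite on \<open>M\<close>: a
  null vector lies in the kernel of the form. It turns minimality of a quadratic form into a linear
  eigenvector equation.\<close>

lemma psd_form_eq_0:
  fixes h :: "'a::complex_inner \<Rightarrow> 'a \<Rightarrow> complex"
  assumes M: "complex_vector.subspace M"
    and add: "\<And>u v w. h (u + v) w = h u w + h v w"
    and scale: "\<And>a u w. h (a *\<^sub>C u) w = a * h u w"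
    and comm: "\<And>u w. h u w = cnj (h w u)"
    and pos: "\<And>u. u \<in> M \<Longrightarrow> Re (h u u) \<ge> 0"
    and x: "x \<in> M" "h x x = 0" and y: "y \<in> M"
  shows "h x y = 0"
proof -
  define k where "k = Re (h y y)"
  define a where "a = h x y"
  \<comment> \<open>With the direction \<open>c\<close> chosen below, the linear term of the form at
    \<open>x + c *\<^sub>C y\<close> is -2 s |a|^2 and the quadratic one is s^2 |a|^2 k;
    \<open>s * k < 1\<close> keeps the linear term dominant.\<close>
  define s where "s = 1 / (k + 1)"
  have k: "k \<ge> 0" using pos[OF y] by (simp add: k_def)
  have s: "s > 0" "s * k < 1" using k by (simp_all add: s_def)
  define c where "c = - (complex_of_real s * a)"
  have add': "h w (u + v) = h w u + h w v" for u v w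
    using add comm by (metis complex_cnj_add)
  have scale': "h w (a *\<^sub>C u) = cnj a * h w u" for a u w
    using scale comm by (metis complex_cnj_mult)
  have hyx: "h y x = cnj a" using comm a_def by blast
  have "x + c *\<^sub>C y \<in> M"
    using M x y by (simp add: complex_vector.subspace_add complex_vector.subspace_scale)
  from pos[OF this] have "0 \<le> Re (c * cnj a + cnj c * a + c * cnj c * h y y)"
    by (simp add: add scale add' scale' x hyx a_def[symmetric] algebra_simps)
  also have "c * cnj a + cnj c * a + c * cnj c * h y y =
      complex_of_real (- 2 * s) * (a * cnj a) + complex_of_real (s * s) * (a * cnj a) * h y y"
    by (simp add: c_def algebra_simps)
  also have "\<dots> = complex_of_real (- 2 * s * (cmod a)\<^sup>2) + complex_of_real (s * s * (cmod a)\<^sup>2) * h y y"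
    by (simp only: complex_norm_square[symmetric] of_real_mult)
  also have "Re \<dots> = - 2 * s * (cmod a)\<^sup>2 + s * s * (cmod a)\<^sup>2 * k"
    by (simp only: k_def plus_complex.sel Re_complex_of_real times_complex.sel Im_complex_of_real)
  also have "\<dots> = s * (cmod a)\<^sup>2 * (s * k - 2)"
    by (simp add: algebra_simps power2_eq_square)
  finally have "s * (cmod a)\<^sup>2 \<le> 0"
    using s by (simp add: zero_le_mult_iff mult_le_0_iff)
  then show ?thesis
    using s by (simp add: a_def mult_le_0_iff)
qed

section \<open>Orthonormal sets\<close>

lemma Pythagoras:
  fixes f :: "'i \<Rightarrow> 'a::complex_inner"
  assumes "finite F" "\<And>i j. i \<in> F \<Longrightarrow> j \<in> F \<Longrightarrow> i \<noteq> j \<Longrightarrow> cinner (f i) (f j) = 0"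
  shows "(norm (\<Sum>i\<in>F. f i))\<^sup>2 = (\<Sum>i\<in>F. (norm (f i))\<^sup>2)"
proof -
  have "complex_of_real ((norm (\<Sum>i\<in>F. f i))\<^sup>2) = (\<Sum>i\<in>F. \<Sum>j\<in>F. cinner (f i) (f j))"
    unfolding cinner_self[symmetric] by (subst cinner_sum_left) (simp add: cinner_sum_right)
  also have "\<dots> = (\<Sum>i\<in>F. \<Sum>j\<in>F. if i = j then cinner (f i) (f i) else 0)"
    using assms(2) by (intro sum.cong) auto
  also have "\<dots> = complex_of_real (\<Sum>i\<in>F. (norm (f i))\<^sup>2)"
    using assms(1) by (simp add: cinner_self)
  finally show ?thesis using of_real_eq_iff by blast
qed

text \<open>The family need not be absolutely summable. By Pythagoras the squared distance of nested
  partial sums is a difference of partial sums of the squared norms, so the net of partial sums is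
  Cauchy.\<close>

lemma summable_on_orthogonal:
  fixes f :: "'i \<Rightarrow> 'a::chilbert_space"
  assumes orth: "\<And>i j. i \<in> A \<Longrightarrow> j \<in> A \<Longrightarrow> i \<noteq> j \<Longrightarrow> cinner (f i) (f j) = 0"
    and bound: "\<And>F. finite F \<Longrightarrow> F \<subseteq> A \<Longrightarrow> (\<Sum>i\<in>F. (norm (f i))\<^sup>2) \<le> K"
  shows "f summable_on A"
proof -
  let ?g = "\<lambda>i. (norm (f i))\<^sup>2"
  have "?g summable_on A"
    using bound by (intro nonneg_bdd_above_summable_on bdd_aboveI2) auto
  then have lim: "(sum ?g \<longlongrightarrow> infsum ?g A) (finite_subsets_at_top A)"
    by (rule infsum_tendsto)
  have "\<exists>P. eventually P (finite_subsets_at_top A) \<and>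
          (\<forall>F F'. P F \<and> P F' \<longrightarrow> dist (sum f F) (sum f F') < e)" if "e > 0" for e
  proof -
    \<comment> \<open>Two partial sums of squares this close to the limit differ by less than
      (e/2)^2. A square root gives e/2, and comparing twice with \<open>F0\<close> gives e.\<close>
    from lim have "\<forall>\<^sub>F F in finite_subsets_at_top A. dist (sum ?g F) (infsum ?g A) < (e/2)\<^sup>2 / 2"
      using that by (intro tendstoD) auto
    then obtain F0 where F0: "finite F0" "F0 \<subseteq> A"
      and close: "\<And>F. finite F \<Longrightarrow> F0 \<subseteq> F \<Longrightarrow> F \<subseteq> A \<Longrightarrow> dist (sum ?g F) (infsum ?g A) < (e/2)\<^sup>2 / 2"
      unfolding eventually_finite_subsets_at_top by auto
    have aux: "a - b < d" if "dist a c < d / 2" "dist b c < d / 2" for a b c d :: real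
      using that unfolding dist_real_def by linarith
    have near: "dist (sum f F) (sum f F0) < e/2" if F: "finite F" "F0 \<subseteq> F" "F \<subseteq> A" for F
    proof -
      have "(dist (sum f F) (sum f F0))\<^sup>2 = (norm (sum f (F - F0)))\<^sup>2"
        using F by (simp add: dist_norm sum_diff)
      also have "\<dots> = sum ?g (F - F0)"
        using F by (intro Pythagoras orth) auto
      also have "\<dots> = sum ?g F - sum ?g F0"
        using F by (simp add: sum_diff)
      also have "\<dots> < (e/2)\<^sup>2"
        using close[OF F] close[OF F0(1) order.refl F0(2)] by (rule aux)
      finally show ?thesis
        by (rule power2_less_imp_less) (use \<open>e > 0\<close> in simp)
    qed
    show ?thesis
    proof (intro exI[of _ "\<lambda>F. finite F \<and> F0 \<subseteq> F \<and> F \<subseteq> A"] conjI allI impI)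
      show "\<forall>\<^sub>F F in finite_subsets_at_top A. finite F \<and> F0 \<subseteq> F \<and> F \<subseteq> A"
        unfolding eventually_finite_subsets_at_top using F0 by blast
      show "dist (sum f F) (sum f F') < e"
        if "(finite F \<and> F0 \<subseteq> F \<and> F \<subseteq> A) \<and> (finite F' \<and> F0 \<subseteq> F' \<and> F' \<subseteq> A)" for F F'
        using near[of F] near[of F'] that dist_triangle_half_l by blast
    qed
  qed
  then have "cauchy_filter (filtermap (sum f) (finite_subsets_at_top A))"
    by (simp add: cauchy_filter_metric_filtermap)
  then obtain L where "(sum f \<longlongrightarrow> L) (finite_subsets_at_top A)"
    using cauchy_filter_complete_converges[of "filtermap (sum f) (finite_subsets_at_top A)" UNIV]
      complete_UNIV by (auto simp: filterlim_def filtermap_bot_iff)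
  then show ?thesis
    unfolding summable_on_def has_sum_def by blast
qed

definition orthonormal :: "'a::complex_inner set \<Rightarrow> bool" where
  "orthonormal B \<longleftrightarrow> (\<forall>b\<in>B. norm b = 1) \<and> (\<forall>b\<in>B. \<forall>c\<in>B. b \<noteq> c \<longrightarrow> cinner b c = 0)"

lemma orthonormal_cinner:
  "orthonormal B \<Longrightarrow> b \<in> B \<Longrightarrow> c \<in> B \<Longrightarrow> cinner b c = (if b = c then 1 else 0)"
  by (auto simp: orthonormal_def cinner_self)

lemma orthonormal_subset: "orthonormal B \<Longrightarrow> C \<subseteq> B \<Longrightarrow> orthonormal C"
  by (auto simp: orthonormal_def)

lemma orthonormal_independent:
  fixes B :: "'a::complex_inner set"
  assumes "orthonormal B"
  shows "complex_vector.independent B"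
proof
  assume "complex_vector.dependent B"
  then obtain t u v where t: "finite t" "t \<subseteq> B" "(\<Sum>w\<in>t. u w *\<^sub>C w) = 0" "v \<in> t" "u v \<noteq> 0"
    unfolding complex_vector.dependent_explicit by auto
  have cvw: "cinner w v = (if w = v then 1 else 0)" if "w \<in> t" for w
    using orthonormal_cinner[OF assms] t that by blast
  have "0 = cinner (\<Sum>w\<in>t. u w *\<^sub>C w) v" by (simp add: t)
  also have "\<dots> = (\<Sum>w\<in>t. if w = v then u w else 0)"
    unfolding cinner_sum_left cinner_simps by (intro sum.cong refl) (simp add: cvw)
  finally show False using t by simp
qed

lemma cfinite_dim_orthonormal:
  assumes "cfinite_dim S" "orthonormal B" "B \<subseteq> S"
  shows "finite B"
  using assms complex_vector.independent_span_bound[OF _ orthonormal_independent[OF assms(2)]]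
  unfolding cfinite_dim_def by blast

lemma cfinite_dim_subset: "cfinite_dim S \<Longrightarrow> R \<subseteq> S \<Longrightarrow> cfinite_dim R"
  unfolding cfinite_dim_def by blast

lemma Bessel:
  fixes B :: "'a::complex_inner set"
  assumes B: "orthonormal B" and F: "finite F" "F \<subseteq> B"
  shows "(\<Sum>b\<in>F. (cmod (cinner x b))\<^sup>2) \<le> (norm x)\<^sup>2"
proof -
  define p where "p = (\<Sum>b\<in>F. cinner x b *\<^sub>C b)"
  have np: "(norm p)\<^sup>2 = (\<Sum>b\<in>F. (cmod (cinner x b))\<^sup>2)"
    unfolding p_def using B F
    by (subst Pythagoras) (auto simp: cinner_simps orthonormal_cinner[OF B] subset_eq orthonormal_def)
  have "cinner x p = (\<Sum>b\<in>F. cinner x b * cnj (cinner x b))"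
    by (simp add: p_def cinner_sum_right cinner_simps mult.commute)
  also have "\<dots> = complex_of_real ((norm p)\<^sup>2)"
    by (simp only: np complex_norm_square of_real_sum)
  finally have xp: "cinner x p = complex_of_real ((norm p)\<^sup>2)" .
  have "(norm p)\<^sup>2 \<le> norm x * norm p"
    using complex_Cauchy_Schwarz[of x p] by (simp add: xp norm_power)
  then have "norm p \<le> norm x"
    by (cases "norm p = 0") (simp_all add: power2_eq_square)
  then show ?thesis
    unfolding np[symmetric] by (simp add: power_mono)
qed

text \<open>Riesz-Fischer, with square summability expressed by a uniform bound on finite
  sums.\<close>

lemma orthonormal_series:
  fixes B :: "'a::chilbert_space set"
  assumes B: "orthonormal B"
    and K: "\<And>F. finite F \<Longrightarrow> F \<subseteq> B \<Longrightarrow> (\<Sum>b\<in>F. (cmod (c b))\<^sup>2) \<le> K"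
  obtains y where "((\<lambda>b. c b *\<^sub>C b) has_sum y) B" "\<And>b. b \<in> B \<Longrightarrow> cinner y b = c b"
proof -
  have "(\<lambda>b. c b *\<^sub>C b) summable_on B"
  proof (rule summable_on_orthogonal)
    show "(\<Sum>b\<in>F. (norm (c b *\<^sub>C b))\<^sup>2) \<le> K" if "finite F" "F \<subseteq> B" for F
    proof -
      have "(\<Sum>b\<in>F. (norm (c b *\<^sub>C b))\<^sup>2) = (\<Sum>b\<in>F. (cmod (c b))\<^sup>2)"
        using B that by (intro sum.cong) (auto simp: orthonormal_def)
      then show ?thesis using K that by simp
    qed
  qed (simp add: cinner_simps orthonormal_cinner[OF B])
  then obtain y where y: "((\<lambda>b. c b *\<^sub>C b) has_sum y) B"
    unfolding summable_on_def by blast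
  moreover have "cinner y b = c b" if "b \<in> B" for b
  proof -
    have "((\<lambda>d. cinner (c d *\<^sub>C d) b) has_sum cinner y b) B"
      using y by (rule has_sum_cinner_left)
    moreover have "((\<lambda>d. cinner (c d *\<^sub>C d) b) has_sum c b) {b}"
      using that by (intro has_sum_finiteI) (auto simp: cinner_simps orthonormal_cinner[OF B])
    then have "((\<lambda>d. cinner (c d *\<^sub>C d) b) has_sum c b) B"
      using that by (subst has_sum_cong_neutral[where T="{b}" and g="\<lambda>d. cinner (c d *\<^sub>C d) b"])
        (auto simp: cinner_simps orthonormal_cinner[OF B])
    ultimately show ?thesis by (rule has_sum_unique)
  qed
  ultimately show ?thesis using that by blast
qed

lemma orthonormal_projection:
  fixes B :: "'a::chilbert_space set"
  assumes B: "orthonormal B"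
  obtains y where "((\<lambda>b. cinner x b *\<^sub>C b) has_sum y) B" "\<And>b. b \<in> B \<Longrightarrow> cinner y b = cinner x b"
  using orthonormal_series[OF B, of "cinner x" "(norm x)\<^sup>2"] Bessel[OF B] by metis

text \<open>Zorn's lemma. \<open>R\<close> is left free because the argument is needed twice: with
  membership in a closed subspace it yields a basis of that subspace, with the eigenvector property
  it yields a maximal set of eigenvectors.\<close>

lemma exists_maximal_orthonormal:
  obtains B :: "'a::complex_inner set" where "orthonormal B" "\<And>b. b \<in> B \<Longrightarrow> R b"
    "\<And>x. R x \<Longrightarrow> norm x = 1 \<Longrightarrow> (\<And>b. b \<in> B \<Longrightarrow> cinner x b = 0) \<Longrightarrow> False"
proof -
  let ?A = "{B :: 'a set. orthonormal B \<and> (\<forall>b\<in>B. R b)}"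
  have "\<exists>M\<in>?A. \<forall>X\<in>?A. M \<subseteq> X \<longrightarrow> X = M"
  proof (rule subset_Zorn')
    fix C assume C: "subset.chain ?A C"
    then have sub: "C \<subseteq> ?A" and lin: "\<And>X Y. X \<in> C \<Longrightarrow> Y \<in> C \<Longrightarrow> X \<subseteq> Y \<or> Y \<subseteq> X"
      unfolding subset_chain_def by auto
    have "cinner b c = 0" if bc: "b \<in> \<Union>C" "c \<in> \<Union>C" "b \<noteq> c" for b c
    proof -
      obtain X Y where X: "X \<in> C" "b \<in> X" and Y: "Y \<in> C" "c \<in> Y" using bc by auto
      then obtain Z where "Z \<in> C" "b \<in> Z" "c \<in> Z"
        using lin[OF X(1) Y(1)] by blast
      then show ?thesis using sub bc(3) by (auto simp: orthonormal_def)
    qed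
    then show "\<Union>C \<in> ?A"
      using sub by (auto simp: orthonormal_def)
  qed
  then obtain M where M: "orthonormal M" "\<forall>b\<in>M. R b"
    and max: "\<And>X. orthonormal X \<Longrightarrow> \<forall>b\<in>X. R b \<Longrightarrow> M \<subseteq> X \<Longrightarrow> X = M"
    by auto
  show ?thesis
  proof (rule that[of M])
    fix x assume x: "R x" "norm x = 1" "\<And>b. b \<in> M \<Longrightarrow> cinner x b = 0"
    then have "insert x M = M"
      using M cinner_eq_0_commute by (intro max) (auto simp: orthonormal_def)
    then have "cinner x x = 0" using x(3) by blast
    then show False using x(2) by auto
  qed (use M in auto)
qed

section \<open>Adjoints\<close>

lemma closed_csubspaceD:
  assumes "closed_csubspace S"
  shows "complex_vector.subspace S" "closed S" "0 \<in> S"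
    "x \<in> S \<Longrightarrow> y \<in> S \<Longrightarrow> x + y \<in> S" "x \<in> S \<Longrightarrow> y \<in> S \<Longrightarrow> x - y \<in> S"
    "x \<in> S \<Longrightarrow> c *\<^sub>C x \<in> S" "x \<in> S \<Longrightarrow> r *\<^sub>R x \<in> S"
  using assms unfolding closed_csubspace_def
  by (auto simp: complex_vector.subspace_0 complex_vector.subspace_add complex_vector.subspace_diff
      complex_vector.subspace_scale simp flip: scaleC_of_real)

lemma closed_csubspace_UNIV [simp]: "closed_csubspace UNIV"
  by (simp add: closed_csubspace_def)

lemma bounded_opsD:
  assumes "f \<in> bounded_ops S R"
  shows "x \<in> S \<Longrightarrow> f x \<in> R" "x \<in> S \<Longrightarrow> y \<in> S \<Longrightarrow> f (x + y) = f x + f y"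
    "x \<in> S \<Longrightarrow> f (c *\<^sub>C x) = c *\<^sub>C f x"
  using assms by (auto simp: bounded_ops_def)

lemma bounded_ops_bound:
  assumes "f \<in> bounded_ops S R"
  obtains K where "K \<ge> 0" "\<And>x. x \<in> S \<Longrightarrow> norm (f x) \<le> K * norm x"
proof -
  obtain K where K: "\<And>x. x \<in> S \<Longrightarrow> norm (f x) \<le> K * norm x"
    using assms unfolding bounded_ops_def by blast
  show ?thesis
  proof (rule that[of "\<bar>K\<bar>"])
    show "norm (f x) \<le> \<bar>K\<bar> * norm x" if "x \<in> S" for x
      using K[OF that] mult_right_mono[OF abs_ge_self norm_ge_zero] by (rule order_trans)
  qed simp
qed

lemma bounded_ops_mono:
  assumes "f \<in> bounded_ops S R" "S' \<subseteq> S" "\<And>x. x \<in> S' \<Longrightarrow> f x \<in> R'"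
  shows "f \<in> bounded_ops S' R'"
proof -
  have sub: "x \<in> S" if "x \<in> S'" for x using assms(2) that by blast
  obtain K where "\<And>x. x \<in> S \<Longrightarrow> norm (f x) \<le> K * norm x"
    using bounded_ops_bound[OF assms(1)] by blast
  then have "\<forall>x\<in>S'. norm (f x) \<le> K * norm x" using sub by blast
  then show ?thesis
    using sub assms(3) bounded_opsD[OF assms(1)] unfolding bounded_ops_def by blast
qed

lemma bounded_ops_bounded_linear:
  assumes "f \<in> bounded_ops UNIV UNIV" shows "bounded_linear f"
proof -
  obtain K where K: "\<And>x. norm (f x) \<le> K * norm x"
    using assms by (auto simp: bounded_ops_def)
  show ?thesis
    using bounded_opsD[OF assms] K
    by (intro bounded_linear_intro[of f K]) (auto simp: mult.commute simp flip: scaleC_of_real)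
qed

lemma bounded_ops_compose:
  assumes "f \<in> bounded_ops S R" "g \<in> bounded_ops R Q"
  shows "(\<lambda>x. g (f x)) \<in> bounded_ops S Q"
proof -
  obtain K where K: "K \<ge> 0" "\<And>x. x \<in> S \<Longrightarrow> norm (f x) \<le> K * norm x"
    using bounded_ops_bound[OF assms(1)] by blast
  obtain L where L: "L \<ge> 0" "\<And>x. x \<in> R \<Longrightarrow> norm (g x) \<le> L * norm x"
    using bounded_ops_bound[OF assms(2)] by blast
  have "norm (g (f x)) \<le> (L * K) * norm x" if "x \<in> S" for x
    using L(2)[of "f x"] K(2)[OF that] bounded_opsD(1)[OF assms(1) that] L(1)
    by (metis ab_semigroup_mult_class.mult_ac(1) mult_left_mono order_trans)
  then show ?thesis
    using bounded_opsD[OF assms(1)] bounded_opsD[OF assms(2)]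
    unfolding bounded_ops_def by auto
qed

lemma bounded_ops_scaleR:
  assumes "f \<in> bounded_ops S S" "closed_csubspace S"
  shows "(\<lambda>x. r *\<^sub>R f x) \<in> bounded_ops S S"
proof -
  obtain K where K: "\<And>x. x \<in> S \<Longrightarrow> norm (f x) \<le> K * norm x"
    using bounded_ops_bound[OF assms(1)] by blast
  have "norm (r *\<^sub>R f x) \<le> (\<bar>r\<bar> * K) * norm x" if "x \<in> S" for x
    using mult_left_mono[OF K[OF that], of "\<bar>r\<bar>"] by simp
  moreover have "r *\<^sub>R c *\<^sub>C x = c *\<^sub>C r *\<^sub>R x" for c and x :: 'a
    by (simp add: scaleC_scaleC mult.commute flip: scaleC_of_real)
  ultimately show ?thesis
    using bounded_opsD[OF assms(1)] closed_csubspaceD[OF assms(2)]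
    unfolding bounded_ops_def by (auto simp: scaleR_add_right)
qed

lemma bounded_ops_zero: assumes "f \<in> bounded_ops S R" "closed_csubspace S" shows "f 0 = 0"
  using bounded_opsD(3)[OF assms(1) closed_csubspaceD(3)[OF assms(2)], of 0] by simp

lemma bounded_ops_sum:
  assumes f: "f \<in> bounded_ops S R" and S: "closed_csubspace S" and "finite F" "\<And>i. i \<in> F \<Longrightarrow> g i \<in> S"
  shows "(\<Sum>i\<in>F. g i) \<in> S \<and> f (\<Sum>i\<in>F. g i) = (\<Sum>i\<in>F. f (g i))"
  using assms(3,4)
  by (induction F)
    (auto simp: bounded_opsD[OF f] bounded_ops_zero[OF f S] closed_csubspaceD[OF S])

lemma closed_csubspace_has_sum:
  assumes "closed_csubspace S" "(f has_sum x) A" "\<And>i. i \<in> A \<Longrightarrow> f i \<in> S"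
  shows "x \<in> S"
proof -
  have "sum f F \<in> S" if "finite F" "F \<subseteq> A" for F
    using assms(3) that closed_csubspaceD(1)[OF assms(1)]
    by (intro complex_vector.subspace_sum) auto
  then have "\<forall>\<^sub>F F in finite_subsets_at_top A. sum f F \<in> S"
    by (simp add: eventually_finite_subsets_at_top_weakI)
  then show ?thesis
    using assms(2) closed_csubspaceD(2)[OF assms(1)]
    unfolding has_sum_def by (metis Lim_in_closed_set finite_subsets_at_top_neq_bot)
qed

lemma exists_orthonormal_basis:
  fixes S :: "'a::chilbert_space set"
  assumes S: "closed_csubspace S"
  obtains B where "orthonormal B" "B \<subseteq> S"
    "\<And>x. x \<in> S \<Longrightarrow> ((\<lambda>b. cinner x b *\<^sub>C b) has_sum x) B"
proof -
  obtain B :: "'a set" where B: "orthonormal B" "\<And>b. b \<in> B \<Longrightarrow> b \<in> S"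
    and max: "\<And>x. x \<in> S \<Longrightarrow> norm x = 1 \<Longrightarrow> (\<And>b. b \<in> B \<Longrightarrow> cinner x b = 0) \<Longrightarrow> False"
    using exists_maximal_orthonormal[of "\<lambda>b. b \<in> S"] by metis
  have "((\<lambda>b. cinner x b *\<^sub>C b) has_sum x) B" if x: "x \<in> S" for x
  proof -
    obtain y where y: "((\<lambda>b. cinner x b *\<^sub>C b) has_sum y) B" "\<And>b. b \<in> B \<Longrightarrow> cinner y b = cinner x b"
      using orthonormal_projection[OF B(1)] by metis
    have "y \<in> S"
      using B(2) closed_csubspaceD(6)[OF S] by (intro closed_csubspace_has_sum[OF S y(1)]) auto
    then have d: "x - y \<in> S" using x closed_csubspaceD(5)[OF S] by blast
    have "x - y = 0"
    proof (rule ccontr)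
      \<comment> \<open>The normalized residual would extend the maximal set.\<close>
      assume "x - y \<noteq> 0"
      then show False
        using closed_csubspaceD(7)[OF S d, of "1 / norm (x - y)"] y(2)
        by (intro max[of "(1 / norm (x - y)) *\<^sub>R (x - y)"]) (auto simp: cinner_simps)
    qed
    then show ?thesis using y(1) by simp
  qed
  then show ?thesis using that B by blast
qed

text \<open>The representing vector is written down in coordinates: its coefficient at
  \<open>b\<close> is forced to be the conjugate of \<open>cinner (f b) y\<close>. An orthonormal
  basis of \<open>S\<close> suffices, so operators that are linear only on \<open>S\<close> are
  covered.\<close>

lemma Riesz_representation:
  fixes S :: "'a::chilbert_space set"
  assumes S: "closed_csubspace S" and f: "f \<in> bounded_ops S R"
  shows "\<exists>z\<in>S. \<forall>x\<in>S. cinner (f x) y = cinner x z"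
proof -
  obtain B where B: "orthonormal B" "B \<subseteq> S"
    and expand: "\<And>x. x \<in> S \<Longrightarrow> ((\<lambda>b. cinner x b *\<^sub>C b) has_sum x) B"
    using exists_orthonormal_basis[OF S] by metis
  obtain K where K: "K \<ge> 0" "\<And>x. x \<in> S \<Longrightarrow> norm (f x) \<le> K * norm x"
    using bounded_ops_bound[OF f] by blast
  define c where "c b = cnj (cinner (f b) y)" for b
  have "(\<Sum>b\<in>F. (cmod (c b))\<^sup>2) \<le> (K * norm y)\<^sup>2" if F: "finite F" "F \<subseteq> B" for F
  proof -
    \<comment> \<open>Test vector: \<open>cinner (f w) y\<close> equals the coefficient sum
      \<open>s\<close>, which is also the square of \<open>norm w\<close>, so the bound on
      \<open>f\<close> gives \<open>norm w \<le> K * norm y\<close>.\<close>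
    define w where "w = (\<Sum>b\<in>F. c b *\<^sub>C b)"
    define s where "s = (\<Sum>b\<in>F. (cmod (c b))\<^sup>2)"
    have FS: "F \<subseteq> S" using F B by blast
    have w: "w \<in> S" "f w = (\<Sum>b\<in>F. c b *\<^sub>C f b)"
      using bounded_ops_sum[OF f S F(1), of "\<lambda>b. c b *\<^sub>C b"] FS closed_csubspaceD(6)[OF S]
        bounded_opsD(3)[OF f] by (auto simp: w_def subset_eq)
    have "(norm w)\<^sup>2 = (\<Sum>b\<in>F. (norm (c b *\<^sub>C b))\<^sup>2)"
      unfolding w_def using B F
      by (intro Pythagoras) (auto simp: cinner_simps orthonormal_cinner[OF B(1)] subset_eq)
    also have "\<dots> = s"
      unfolding s_def using B F by (intro sum.cong) (auto simp: orthonormal_def)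
    finally have nw: "(norm w)\<^sup>2 = s" .
    have "cinner (f w) y = (\<Sum>b\<in>F. c b * cnj (c b))"
      by (simp add: w cinner_sum_left cinner_simps c_def)
    also have "\<dots> = complex_of_real s"
      by (simp only: s_def complex_norm_square of_real_sum)
    finally have "s \<le> norm (f w) * norm y"
      using complex_Cauchy_Schwarz[of "f w" y] nw by (metis abs_le_D1 norm_of_real)
    also have "\<dots> \<le> (K * norm w) * norm y"
      using K(2)[OF w(1)] by (intro mult_right_mono) simp_all
    finally have "norm w * norm w \<le> (K * norm y) * norm w"
      using nw by (simp add: power2_eq_square algebra_simps)
    then have "norm w \<le> K * norm y"
      using K(1) by (cases "w = 0") auto
    then show ?thesis
      using nw s_def by (metis norm_ge_zero power_mono)
  qed
  from orthonormal_series[OF B(1) this]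
  obtain z where z: "((\<lambda>b. c b *\<^sub>C b) has_sum z) B" "\<And>b. b \<in> B \<Longrightarrow> cinner z b = c b"
    by metis
  have zS: "z \<in> S"
    using B(2) closed_csubspaceD(6)[OF S] by (intro closed_csubspace_has_sum[OF S z(1)]) auto
  have "cinner (f x) y = cinner x z" if x: "x \<in> S" for x
  proof -
    have "((\<lambda>b. cinner x (c b *\<^sub>C b)) has_sum cinner x z) B"
      using z(1) by (rule has_sum_cinner_right)
    then have 1: "((\<lambda>b. cinner x b * cinner (f b) y) has_sum cinner x z) B"
      by (simp add: cinner_simps c_def mult.commute)
    \<comment> \<open>\<open>f\<close> is linear and bounded on \<open>S\<close> only, so the
      passage to the limit applies the bound \<open>K\<close> to differences that stay in
      \<open>S\<close>.\<close>
    have "((\<lambda>b. cinner (f (cinner x b *\<^sub>C b)) y) has_sum cinner (f x) y) B"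
      unfolding has_sum_def
    proof (rule Lim_transform_eventually[where f = "\<lambda>F. cinner (f (\<Sum>b\<in>F. cinner x b *\<^sub>C b)) y"])
      let ?FF = "finite_subsets_at_top B" and ?s = "\<lambda>F. \<Sum>b\<in>F. cinner x b *\<^sub>C b"
      have sub: "finite F \<Longrightarrow> F \<subseteq> B \<Longrightarrow> ?s F \<in> S \<and> f (?s F) = (\<Sum>b\<in>F. f (cinner x b *\<^sub>C b))" for F
        using B(2) closed_csubspaceD(6)[OF S] by (intro bounded_ops_sum[OF f S]) auto
      show "\<forall>\<^sub>F F in ?FF. cinner (f (?s F)) y = (\<Sum>b\<in>F. cinner (f (cinner x b *\<^sub>C b)) y)"
        using sub by (intro eventually_finite_subsets_at_top_weakI) (simp add: cinner_sum_left)
      have lim: "(?s \<longlongrightarrow> x) ?FF"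
        using expand[OF x] unfolding has_sum_def .
      have "((\<lambda>F. K * norm (?s F - x)) \<longlongrightarrow> K * 0) ?FF"
        by (intro tendsto_mult_left tendsto_norm_zero LIM_zero lim)
      then have lim0: "((\<lambda>F. K * norm (?s F - x)) \<longlongrightarrow> 0) ?FF"
        by (simp only: mult_zero_right)
      have "((\<lambda>F. f (?s F) - f x) \<longlongrightarrow> 0) ?FF"
      proof (rule Lim_null_comparison[OF _ lim0])
        show "\<forall>\<^sub>F F in ?FF. norm (f (?s F) - f x) \<le> K * norm (?s F - x)"
        proof (intro eventually_finite_subsets_at_top_weakI)
          fix F assume F: "finite F" "F \<subseteq> B"
          then have d: "?s F - x \<in> S" using sub x closed_csubspaceD(5)[OF S] by blast
          have "f (?s F - x) + f x = f (?s F)"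
            using bounded_opsD(2)[OF f d x] by simp
          then have "f (?s F) - f x = f (?s F - x)" by (metis add_diff_cancel_right')
          then show "norm (f (?s F) - f x) \<le> K * norm (?s F - x)" using K(2)[OF d] by simp
        qed
      qed
      then have "((\<lambda>F. f (?s F)) \<longlongrightarrow> f x) ?FF"
        by (rule LIM_zero_cancel)
      then show "((\<lambda>F. cinner (f (?s F)) y) \<longlongrightarrow> cinner (f x) y) ?FF"
        by (intro bounded_linear.tendsto[OF bounded_linear_cinner_left])
    qed
    then have "((\<lambda>b. cinner x b * cinner (f b) y) has_sum cinner (f x) y) B"
      using B(2) bounded_opsD(3)[OF f]
      by (subst has_sum_cong[where g="\<lambda>b. cinner (f (cinner x b *\<^sub>C b)) y"]) (auto simp: cinner_simps subset_eq)
    then show ?thesis using 1 by (rule has_sum_unique)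
  qed
  then show ?thesis using zS by blast
qed

lemma adj_on_eqI:
  assumes S: "closed_csubspace S" and y: "y \<in> R" and z: "z \<in> S" "\<And>x. x \<in> S \<Longrightarrow> cinner (f x) y = cinner x z"
  shows "adj_on S R f y = z"
proof -
  have "(THE z. z \<in> S \<and> (\<forall>x\<in>S. cinner (f x) y = cinner x z)) = z"
  proof (rule the_equality)
    fix w assume w: "w \<in> S \<and> (\<forall>x\<in>S. cinner (f x) y = cinner x w)"
    then have "cinner (w - z) (w - z) = 0"
      using z closed_csubspaceD(5)[OF S, of w z] by (metis cinner_diff_right diff_self)
    then show "w = z" by simp
  qed (use z in auto)
  then show ?thesis using y by (simp add: adj_on_def)
qed

lemma adj_on_spec:
  fixes S :: "'a::chilbert_space set"
  assumes "closed_csubspace S" "f \<in> bounded_ops S R" "y \<in> R"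
  shows "adj_on S R f y \<in> S" "x \<in> S \<Longrightarrow> cinner (f x) y = cinner x (adj_on S R f y)"
proof -
  obtain z where "z \<in> S" "\<And>x. x \<in> S \<Longrightarrow> cinner (f x) y = cinner x z"
    using Riesz_representation[OF assms(1,2)] by metis
  then show "adj_on S R f y \<in> S" "x \<in> S \<Longrightarrow> cinner (f x) y = cinner x (adj_on S R f y)"
    using adj_on_eqI[OF assms(1,3), of z f] by auto
qed

section \<open>Diagonalization of absolutely minimum attaining operators\<close>

lemma closed_csubspace_orthogonal: "closed_csubspace {x :: 'a::complex_inner. \<forall>y\<in>Y. cinner x y = 0}"
proof -
  have "closed {x :: 'a. cinner x y = 0}" for y
    by (intro closed_Collect_eq continuous_intros bounded_linear.continuous_on[OF bounded_linear_cinner_left])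
  then have "closed (\<Inter>y\<in>Y. {x :: 'a. cinner x y = 0})"
    by (intro closed_INT) blast
  also have "(\<Inter>y\<in>Y. {x :: 'a. cinner x y = 0}) = {x. \<forall>y\<in>Y. cinner x y = 0}"
    by blast
  finally show ?thesis
    unfolding closed_csubspace_def
    by (intro conjI complex_vector.subspaceI) (simp_all add: cinner_simps)
qed

text \<open>The Euler-Lagrange equation of the minimization: \<open>h\<close> below is a Hermitian
  form, nonnegative on \<open>M\<close> by minimality of \<open>x\<close> and zero at
  \<open>x\<close>, so \<open>x\<close> lies in its kernel.\<close>

lemma minimizer_form:
  fixes T :: "'a::complex_inner \<Rightarrow> 'a"
  assumes T: "T \<in> bounded_ops UNIV UNIV" and M: "complex_vector.subspace M"
    and x: "x \<in> M" "norm x = 1" and min: "\<And>u. u \<in> M \<Longrightarrow> norm u = 1 \<Longrightarrow> norm (T x) \<le> norm (T u)"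
    and y: "y \<in> M"
  shows "cinner (T x) (T y) = complex_of_real ((norm (T x))\<^sup>2) * cinner x y"
proof -
  define h where "h u w = cinner (T u) (T w) - complex_of_real ((norm (T x))\<^sup>2) * cinner u w" for u w
  interpret T: bounded_linear T using T by (rule bounded_ops_bounded_linear)
  have "h x y = 0"
  proof (rule psd_form_eq_0[OF M])
    show "h (u + v) w = h u w + h v w" for u v w
      by (simp add: h_def T.add cinner_simps ring_distribs)
    show "h (a *\<^sub>C u) w = a * h u w" for a u w
      by (simp add: h_def bounded_opsD(3)[OF T] cinner_simps ring_distribs)
    show "h u w = cnj (h w u)" for u w
      unfolding h_def complex_cnj_diff complex_cnj_mult complex_cnj_complex_of_real
      by (simp only: cinner_commute[symmetric])
    show "Re (h u u) \<ge> 0" if u: "u \<in> M" for u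
    proof (cases "u = 0")
      case False
      define w where "w = (1 / norm u) *\<^sub>R u"
      have w: "w \<in> M" "norm w = 1"
        using M u False unfolding w_def scaleC_of_real[symmetric]
        by (auto intro: complex_vector.subspace_scale simp del: of_real_divide)
      have u_eq: "u = norm u *\<^sub>R w" using False by (simp add: w_def)
      have "norm (T u) = norm u * norm (T w)"
        by (subst u_eq) (simp add: T.scaleR)
      then have "norm (T x) * norm u \<le> norm (T u)"
        using min[OF w] by (simp add: mult.commute mult_left_mono)
      then have "(norm (T x) * norm u)\<^sup>2 \<le> (norm (T u))\<^sup>2"
        by (intro power_mono) auto
      then show ?thesis
        by (simp only: h_def cinner_self minus_complex.sel of_real_mult[symmetric] Re_complex_of_real)
          (simp add: power_mult_distrib)
    qed (simp add: h_def T.zero)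
    show "h x x = 0"
      by (simp only: h_def cinner_self x(2)) simp
  qed (use x y in auto)
  then show ?thesis by (simp add: h_def)
qed

lemma AM_minimizer:
  fixes T :: "'a::complex_inner \<Rightarrow> 'a"
  assumes "AM_op T" "closed_csubspace M" "M \<noteq> {0}"
  shows "\<exists>x\<in>M. norm x = 1 \<and> (\<forall>u\<in>M. norm u = 1 \<longrightarrow> norm (T x) \<le> norm (T u)) \<and>
    (\<forall>y\<in>M. cinner (T x) (T y) = complex_of_real ((norm (T x))\<^sup>2) * cinner x y)"
proof -
  have T: "T \<in> bounded_ops UNIV UNIV" and "min_attaining M T"
    using assms by (auto simp: AM_op_def)
  then obtain x where x: "x \<in> M" "norm x = 1" "norm (T x) = min_modulus M T"
    by (auto simp: min_attaining_def)
  have min: "norm (T x) \<le> norm (T u)" if "u \<in> M" "norm u = 1" for u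
    unfolding x(3) min_modulus_def
    using that by (intro cInf_lower bdd_belowI[of _ 0]) auto
  show ?thesis
    using x(1,2) min minimizer_form[OF T closed_csubspaceD(1)[OF assms(2)] x(1,2) min] by blast
qed

lemma adj_spec:
  fixes T :: "'a::chilbert_space \<Rightarrow> 'a"
  assumes "T \<in> bounded_ops UNIV UNIV"
  shows "cinner (T x) y = cinner x (adj T y)"
  using adj_on_spec(2)[OF closed_csubspace_UNIV assms] by simp

text \<open>The minimizer equation holds a priori only against vectors of \<open>M\<close>. Because
  \<open>M\<close> is the complement of eigenvectors of \<open>adj T \<circ> T\<close>, it is
  invariant under that operator, and the equation extends to the whole space.\<close>

lemma AM_eigenbasis:
  fixes T :: "'a::chilbert_space \<Rightarrow> 'a"
  assumes AM: "AM_op T"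
  obtains B where "orthonormal B" "\<And>x. (\<And>b. b \<in> B \<Longrightarrow> cinner x b = 0) \<Longrightarrow> x = 0"
    "\<And>x b. b \<in> B \<Longrightarrow> cinner (T x) (T b) = complex_of_real ((norm (T b))\<^sup>2) * cinner x b"
proof -
  have T: "T \<in> bounded_ops UNIV UNIV" using AM by (simp add: AM_op_def)
  let ?R = "\<lambda>b. \<forall>x. cinner (T x) (T b) = complex_of_real ((norm (T b))\<^sup>2) * cinner x b"
  obtain B :: "'a set" where B: "orthonormal B" "\<And>b. b \<in> B \<Longrightarrow> ?R b"
    and max: "\<And>x. ?R x \<Longrightarrow> norm x = 1 \<Longrightarrow> (\<And>b. b \<in> B \<Longrightarrow> cinner x b = 0) \<Longrightarrow> False"
    using exists_maximal_orthonormal[of ?R] by blast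
  define M where "M = {x. \<forall>b\<in>B. cinner x b = 0}"
  have "M = {0}"
  proof (rule ccontr)
    assume "M \<noteq> {0}"
    moreover have "closed_csubspace M"
      unfolding M_def by (rule closed_csubspace_orthogonal)
    ultimately obtain x where x: "x \<in> M" "norm x = 1"
      and ev: "\<And>y. y \<in> M \<Longrightarrow> cinner (T x) (T y) = complex_of_real ((norm (T x))\<^sup>2) * cinner x y"
      using AM_minimizer[OF AM, of M] by auto
    define r where "r = complex_of_real ((norm (T x))\<^sup>2)"
    \<comment> \<open>Residual of the eigenvector equation. It is orthogonal to \<open>B\<close>,
      hence in \<open>M\<close>, and the minimizer equation tested against \<open>w\<close> itself
      gives \<open>cinner w w = 0\<close>.\<close>
    define w where "w = adj T (T x) - r *\<^sub>C x"
    have cr: "cnj r = r" by (simp add: r_def)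
    have yw: "cinner y w = cinner (T y) (T x) - r * cinner y x" for y
      by (simp add: w_def cinner_simps adj_spec[OF T] cr)
    have "cinner w b = 0" if b: "b \<in> B" for b
    proof -
      have "cinner x b = 0" using x b by (simp add: M_def)
      then have "cinner (T x) (T b) = 0" "cinner b x = 0"
        using B(2)[OF b] cinner_eq_0_commute by auto
      then show ?thesis
        using yw[of b] cinner_eq_0_commute by (metis diff_zero mult_zero_right)
    qed
    then have "w \<in> M" by (simp add: M_def)
    then have "cinner (T x) (T w) = r * cinner x w" using ev r_def by blast
    then have "cinner (T w) (T x) = r * cinner w x"
      by (metis cinner_commute complex_cnj_mult cr)
    then have "cinner w w = 0" by (simp add: yw)
    then have "cinner (T y) (T x) = r * cinner y x" for y
      using yw[of y] by simp
    then show False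
      using max[of x] x by (simp add: r_def M_def)
  qed
  show ?thesis
  proof (rule that[OF B(1)])
    show "x = 0" if "\<And>b. b \<in> B \<Longrightarrow> cinner x b = 0" for x
      using that \<open>M = {0}\<close> by (auto simp: M_def)
    show "cinner (T x) (T b) = complex_of_real ((norm (T b))\<^sup>2) * cinner x b" if "b \<in> B" for x b
      using B(2)[OF that] by simp
  qed
qed

text \<open>On the closed span of such a sequence the infimum of the \<open>v n\<close> is the squared minimum modulus,
  and it is not attained.\<close>

lemma AM_no_decreasing_sequence:
  fixes T :: "'a::chilbert_space \<Rightarrow> 'a" and x :: "nat \<Rightarrow> 'a"
  assumes AM: "AM_op T" and v: "\<And>n. v (Suc n) < v n"
    and orth: "\<And>i j. cinner (x i) (x j) = (if i = j then 1 else 0)"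
    and Torth: "\<And>i j. cinner (T (x i)) (T (x j)) = (if i = j then complex_of_real (v i) else 0)"
  shows False
proof -
  have T: "T \<in> bounded_ops UNIV UNIV" using AM by (simp add: AM_op_def)
  \<comment> \<open>Double orthogonal complement, so \<open>M\<close> is the closed span of the
    \<open>x n\<close>.\<close>
  define N where "N = {w. \<forall>n. cinner (x n) w = 0}"
  define M where "M = {z. \<forall>w\<in>N. cinner z w = 0}"
  have xM: "x n \<in> M" for n by (auto simp: M_def N_def)
  have nx: "norm (x n) = 1" for n
  proof -
    have "(norm (x n))\<^sup>2 = 1" using cinner_self_real(2)[of "x n"] orth[of n n] by simp
    then show ?thesis using norm_ge_zero[of "x n"] by (metis power2_eq_1_iff neg_0_le_iff_le not_one_le_zero)
  qed
  have "M \<noteq> {0}" using xM[of 0] nx[of 0] by auto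
  moreover have "closed_csubspace M"
    unfolding M_def by (rule closed_csubspace_orthogonal)
  ultimately obtain z where z: "z \<in> M" "norm z = 1"
    and min: "\<And>u. u \<in> M \<Longrightarrow> norm u = 1 \<Longrightarrow> norm (T z) \<le> norm (T u)"
    and ev: "\<And>y. y \<in> M \<Longrightarrow> cinner (T z) (T y) = complex_of_real ((norm (T z))\<^sup>2) * cinner z y"
    using AM_minimizer[OF AM, of M] by auto
  have "cinner (x n) z = 0" for n
  proof -
    have "(norm (T z))\<^sup>2 \<le> (norm (T (x (Suc n))))\<^sup>2"
      using min[OF xM nx] by (intro power_mono) auto
    also have "\<dots> = v (Suc n)"
      using cinner_self_real(2)[of "T (x (Suc n))"] Torth[of "Suc n" "Suc n"] by simp
    finally have lt: "(norm (T z))\<^sup>2 < v n" using v[of n] by linarith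
    \<comment> \<open>\<open>adj T \<circ> T\<close> need not preserve \<open>M\<close>, but by
      diagonality its value at \<open>x n\<close> differs from
      \<open>complex_of_real (v n) *\<^sub>C x n\<close> only by a vector orthogonal to
      \<open>M\<close>. So \<open>z\<close> satisfies the equation at \<open>x n\<close> both with
      \<open>v n\<close> and with the smaller value of the minimizer, which forces it to be
      orthogonal to \<open>x n\<close>.\<close>
    define w where "w = adj T (T (x n)) - complex_of_real (v n) *\<^sub>C x n"
    have "cinner (x k) w = 0" for k
      by (simp add: w_def cinner_simps adj_spec[OF T, symmetric] orth Torth)
    then have "cinner z w = 0" using z(1) by (simp add: M_def N_def)
    then have "cinner (T z) (T (x n)) = complex_of_real (v n) * cinner z (x n)"
      by (simp add: w_def cinner_simps adj_spec[OF T, symmetric])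
    with ev[OF xM[of n]] have "complex_of_real (v n - (norm (T z))\<^sup>2) * cinner z (x n) = 0"
      by (simp add: algebra_simps)
    then show ?thesis using lt cinner_eq_0_commute[of z] by (simp del: of_real_diff)
  qed
  then have "cinner z z = 0" using z(1) by (simp add: M_def N_def)
  then show False using z(2) by auto
qed

text \<open>Pairing an eigenvector of eigenvalue \<open>\<le> s\<close> (up to a small error) with one of eigenvalue
  \<open>> s\<close> and mixing them produces any intermediate value of the quadratic form; infinitely many
  disjoint pairs would therefore give a sequence excluded by the previous lemma.\<close>

lemma AM_finite_above:
  fixes T :: "'a::chilbert_space \<Rightarrow> 'a" and l :: "'a \<Rightarrow> real"
  assumes AM: "AM_op T" and B: "orthonormal B"
    and TB: "\<And>b c. b \<in> B \<Longrightarrow> c \<in> B \<Longrightarrow> cinner (T b) (T c) = (if b = c then complex_of_real (l b) else 0)"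
    and inf: "\<And>d. d > s \<Longrightarrow> infinite {b\<in>B. l b < d}"
  shows "finite {b\<in>B. l b > s}"
proof (rule ccontr)
  assume inf': "infinite {b\<in>B. l b > s}"
  interpret T: bounded_linear T
    using AM by (intro bounded_ops_bounded_linear) (simp add: AM_op_def)
  \<comment> \<open>A fresh pair outside the finite set \<open>U\<close> of used vectors. The target
    \<open>v\<close> is fixed after \<open>f\<close> and before \<open>e\<close>: it must lie below
    \<open>v0\<close> and \<open>l f\<close>, and staying above \<open>s\<close> leaves infinitely
    many candidates for \<open>e\<close>.\<close>
  have step: "\<exists>e f v. e \<in> B - U \<and> f \<in> B - U \<and> s < v \<and> v < v0 \<and> l e < v \<and> v < l f"
    if "finite U" "v0 > s" for U v0
  proof -
    have "infinite ({b\<in>B. l b > s} - U)"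
      by (rule Diff_infinite_finite[OF that(1)]) (rule inf')
    then have "{b\<in>B. l b > s} - U \<noteq> {}" by (rule infinite_imp_nonempty)
    then obtain f where f: "f \<in> B" "l f > s" "f \<notin> U" by blast
    define v where "v = (s + min v0 (l f)) / 2"
    have v: "s < v" "v < v0" "v < l f" using f that by (auto simp: v_def min_def)
    have "infinite ({b\<in>B. l b < v} - U)"
      by (rule Diff_infinite_finite[OF that(1)]) (rule inf[OF v(1)])
    then have "{b\<in>B. l b < v} - U \<noteq> {}" by (rule infinite_imp_nonempty)
    then obtain e where "e \<in> B" "l e < v" "e \<notin> U" by blast
    then show ?thesis using f v by auto
  qed
  \<comment> \<open>State of the recursive choice: all vectors used so far, the current pair and its
    target value.\<close>
  define P where "P = (\<lambda>(n :: nat) (U, e, f, v). finite (U :: 'a set) \<and> e \<in> U \<and> f \<in> U \<and> e \<in> B \<and> f \<in> B \<and>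
      s < v \<and> l e < v \<and> v < l f)"
  define Q where "Q = (\<lambda>(n :: nat) (U :: 'a set, e :: 'a, f :: 'a, v :: real) (U', e', f', v').
      U \<subseteq> U' \<and> e' \<notin> U \<and> f' \<notin> U \<and> v' < v)"
  have "\<exists>st. \<forall>n. P n (st n) \<and> Q n (st n) (st (Suc n))"
  proof (rule dependent_nat_choice)
    obtain e f v where "e \<in> B - {}" "f \<in> B - {}" "s < v" "l e < v" "v < l f"
      using step[of "{}" "s + 1"] by auto
    then have "P 0 ({e, f}, e, f, v)" by (simp add: P_def)
    then show "\<exists>x. P 0 x" by blast
  next
    fix x n assume "P n x"
    then obtain U e f v where x: "x = (U, e, f, v)" "finite U" "s < v"
      by (cases x) (auto simp: P_def)
    obtain e' f' v' where "e' \<in> B - U" "f' \<in> B - U" "s < v'" "v' < v" "l e' < v'" "v' < l f'"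
      using step[OF x(2,3)] by metis
    then have "P (Suc n) (insert e' (insert f' U), e', f', v') \<and> Q n x (insert e' (insert f' U), e', f', v')"
      using x by (auto simp: P_def Q_def)
    then show "\<exists>y. P (Suc n) y \<and> Q n x y" by blast
  qed
  then obtain st where st: "\<And>n. P n (st n)" "\<And>n. Q n (st n) (st (Suc n))" by blast
  define U e f v where "U n = fst (st n)" and "e n = fst (snd (st n))" and
    "f n = fst (snd (snd (st n)))" and "v n = snd (snd (snd (st n)))" for n
  have st_eq: "st n = (U n, e n, f n, v n)" for n
    by (simp add: U_def e_def f_def v_def)
  have p: "e n \<in> U n" "f n \<in> U n" "e n \<in> B" "f n \<in> B" "l (e n) < v n" "v n < l (f n)" for n
    using st(1)[of n] by (simp_all add: P_def st_eq)
  have q: "U n \<subseteq> U (Suc n)" "e (Suc n) \<notin> U n" "f (Suc n) \<notin> U n" "v (Suc n) < v n" for n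
    using st(2)[of n] by (simp_all add: Q_def st_eq)
  have U_mono: "U i \<subseteq> U j" if "i \<le> j" for i j
    using q(1) that by (rule lift_Suc_mono_le)
  have fresh: "e j \<notin> U i" "f j \<notin> U i" if "i < j" for i j
  proof -
    obtain k where "j = Suc k" "i \<le> k" using \<open>i < j\<close> by (cases j) auto
    then show "e j \<notin> U i" "f j \<notin> U i" using U_mono[of i k] q(2,3)[of k] by auto
  qed
  have dist: "e i \<noteq> e j" "e i \<noteq> f j" "f i \<noteq> e j" "f i \<noteq> f j" if "i \<noteq> j" for i j
    using that fresh[of i j] fresh[of j i] p(1,2)[of i] p(1,2)[of j] by (metis linorder_neqE_nat)+
  have ef: "e i \<noteq> f i" for i using p(5,6)[of i] by auto
  \<comment> \<open>Weights solving a^2 + c^2 = 1 and a^2 l(e) + c^2 l(f) = v. Cross terms vanish in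
    both forms, since \<open>B\<close> and its image under \<open>T\<close> are orthogonal
    families.\<close>
  define a c where "a n = sqrt ((l (f n) - v n) / (l (f n) - l (e n)))"
    and "c n = sqrt ((v n - l (e n)) / (l (f n) - l (e n)))" for n
  have ac: "a n * a n + c n * c n = 1" "a n * a n * l (e n) + c n * c n * l (f n) = v n" for n
  proof -
    have d: "l (f n) - l (e n) > 0" using p(5,6)[of n] by simp
    have aa: "a n * a n = (l (f n) - v n) / (l (f n) - l (e n))"
      and cc: "c n * c n = (v n - l (e n)) / (l (f n) - l (e n))"
      using p(5,6)[of n] d by (simp_all add: a_def c_def)
    show "a n * a n + c n * c n = 1" using d by (simp add: aa cc divide_simps)
    show "a n * a n * l (e n) + c n * c n * l (f n) = v n"
      unfolding aa cc using d by (simp add: divide_simps) (simp add: algebra_simps)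
  qed
  define x where "x n = a n *\<^sub>R e n + c n *\<^sub>R f n" for n
  have Tx: "T (x n) = a n *\<^sub>R T (e n) + c n *\<^sub>R T (f n)" for n
    by (simp add: x_def T.add T.scaleR)
  show False
  proof (rule AM_no_decreasing_sequence[OF AM, of v x])
    show "cinner (x i) (x j) = (if i = j then 1 else 0)" for i j
    proof (cases "i = j")
      case True
      have "cinner (x i) (x i) = complex_of_real (a i * a i + c i * c i)"
        unfolding x_def cinner_simps using ef[of i] ef[of i, symmetric]
        by (simp add: orthonormal_cinner[OF B] p)
      then show ?thesis using ac True by simp
    next
      case False
      then show ?thesis
        unfolding x_def cinner_simps by (simp add: orthonormal_cinner[OF B] p dist)
    qed
    show "cinner (T (x i)) (T (x j)) = (if i = j then complex_of_real (v i) else 0)" for i j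
    proof (cases "i = j")
      case True
      have "cinner (T (x i)) (T (x i)) = complex_of_real (a i * a i * l (e i) + c i * c i * l (f i))"
        unfolding Tx cinner_simps using ef[of i] ef[of i, symmetric]
        by (simp add: TB p mult.assoc)
      then show ?thesis using ac True by simp
    next
      case False
      then show ?thesis
        unfolding Tx cinner_simps by (simp add: TB p dist)
    qed
  qed (rule q(4))
qed

text \<open>The equation \<open>T\<^sup>* T b = (\<mu> b)\<^sup>2 b\<close> is stated weakly, so \<open>\<mu> b\<close> is an eigenvalue of \<open>|T|\<close>.\<close>

locale diagonalized =
  fixes T :: "'a::chilbert_space \<Rightarrow> 'a" and B :: "'a set" and \<mu> :: "'a \<Rightarrow> real" and \<beta> :: real
  assumes T: "T \<in> bounded_ops UNIV UNIV"
    and B: "orthonormal B" and infinite_B: "infinite B"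
    and complete: "\<And>x. (\<And>b. b \<in> B \<Longrightarrow> cinner x b = 0) \<Longrightarrow> x = 0"
    and \<mu>_nonneg: "\<And>b. b \<in> B \<Longrightarrow> 0 \<le> \<mu> b" and \<beta>_nonneg: "0 \<le> \<beta>"
    and T_eigen: "\<And>x b. b \<in> B \<Longrightarrow> cinner (T x) (T b) = complex_of_real ((\<mu> b)\<^sup>2) * cinner x b"
    and finite_above: "finite {b\<in>B. \<mu> b > \<beta>}"
    and finite_below: "\<And>t. t < \<beta> \<Longrightarrow> finite {b\<in>B. \<mu> b < t}"

text \<open>The finiteness conditions are proved for the squares \<open>l b\<close>, which the
  minimizer equation supplies directly; roots are taken only at the end. Infinite dimension makes
  \<open>B\<close> infinite, which is what makes the set \<open>I\<close> nonempty.\<close>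

lemma AM_diagonalized:
  fixes T :: "'a::chilbert_space \<Rightarrow> 'a"
  assumes AM: "AM_op T" and "\<not> cfinite_dim (UNIV :: 'a set)"
  obtains B \<mu> \<beta> where "diagonalized T B \<mu> \<beta>"
proof -
  obtain B where B: "orthonormal B" and complete: "\<And>x. (\<And>b. b \<in> B \<Longrightarrow> cinner x b = 0) \<Longrightarrow> x = 0"
    and TB: "\<And>x b. b \<in> B \<Longrightarrow> cinner (T x) (T b) = complex_of_real ((norm (T b))\<^sup>2) * cinner x b"
    using AM_eigenbasis[OF AM] by blast
  have T: "T \<in> bounded_ops UNIV UNIV" using AM by (simp add: AM_op_def)
  obtain K where K: "K \<ge> 0" "\<And>x. norm (T x) \<le> K * norm x"
    using bounded_ops_bound[OF T] by (metis UNIV_I)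
  have infB: "infinite B"
  proof
    assume fin: "finite B"
    have "x \<in> complex_vector.span B" for x
    proof -
      let ?y = "\<Sum>b\<in>B. cinner x b *\<^sub>C b"
      have "cinner (x - ?y) c = 0" if "c \<in> B" for c
      proof -
        have "cinner ?y c = (\<Sum>b\<in>B. if b = c then cinner x b else 0)"
          unfolding cinner_sum_left cinner_simps using that
          by (intro sum.cong refl) (simp add: orthonormal_cinner[OF B])
        then show ?thesis using fin that by (simp add: cinner_simps)
      qed
      then have "x - ?y = 0" by (rule complete)
      then have "x = ?y" by simp
      also have "\<dots> \<in> complex_vector.span B"
        by (intro complex_vector.span_sum complex_vector.span_scale complex_vector.span_base)
      finally show ?thesis .
    qed
    then show False using assms(2) fin unfolding cfinite_dim_def by blast
  qed
  define l where "l b = (norm (T b))\<^sup>2" for b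
  define I where "I = {t. infinite {b\<in>B. l b < t}}"
  define c where "c = Inf I"
  \<comment> \<open>Adding 1 makes the bound strict, so every basis vector counts and
    \<open>K\<^sup>2 + 1\<close> belongs to \<open>I\<close>.\<close>
  have "l b < K\<^sup>2 + 1" if "b \<in> B" for b
    using power_mono[OF K(2)[of b] norm_ge_zero, of 2] B that by (simp add: l_def orthonormal_def)
  then have "{b\<in>B. l b < K\<^sup>2 + 1} = B" by auto
  then have "K\<^sup>2 + 1 \<in> I" using infB by (simp add: I_def)
  then have I_ne: "I \<noteq> {}" by blast
  have I_pos: "0 \<le> t" if "t \<in> I" for t
  proof -
    have "{b\<in>B. l b < t} \<noteq> {}" using that infinite_imp_nonempty unfolding I_def by auto
    then obtain b where "l b < t" by auto
    then show ?thesis using zero_le_power2[of "norm (T b)"] unfolding l_def by linarith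
  qed
  have I_bdd: "bdd_below I" using I_pos by (intro bdd_belowI[of _ 0])
  have c0: "0 \<le> c" unfolding c_def using I_ne I_pos by (rule cInf_greatest)
  have below: "finite {b\<in>B. l b < t}" if "t < c" for t
    using that cInf_lower[OF _ I_bdd, of t] unfolding c_def I_def by force
  have "infinite {b\<in>B. l b < d}" if "d > c" for d
  proof -
    obtain t where t: "t \<in> I" "t < d" using cInf_lessD[OF I_ne] \<open>d > c\<close> c_def by blast
    have "{b\<in>B. l b < t} \<subseteq> {b\<in>B. l b < d}" using t by auto
    then show ?thesis using t(1) infinite_super unfolding I_def by blast
  qed
  moreover have "cinner (T a) (T b) = (if a = b then complex_of_real (l a) else 0)"
    if "a \<in> B" "b \<in> B" for a b
    using TB[OF that(2), of a] orthonormal_cinner[OF B that] by (simp add: l_def)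
  ultimately have above: "finite {b\<in>B. l b > c}"
    by (intro AM_finite_above[OF AM B])
  have "diagonalized T B (\<lambda>b. sqrt (l b)) (sqrt c)"
  proof
    show "cinner (T x) (T b) = complex_of_real ((sqrt (l b))\<^sup>2) * cinner x b" if "b \<in> B" for x b
      using TB[OF that] by (simp add: l_def)
    show "finite {b\<in>B. sqrt c < sqrt (l b)}" using above by simp
    show "finite {b\<in>B. sqrt (l b) < t}" if "t < sqrt c" for t
    proof (cases "0 \<le> t")
      case True
      have "t\<^sup>2 < c" using True that by (metis real_less_rsqrt real_sqrt_unique linorder_not_le
            real_le_lsqrt c0 order.strict_iff_not)
      moreover have "{b\<in>B. sqrt (l b) < t} \<subseteq> {b\<in>B. l b < t\<^sup>2}"
        using True by (auto simp: real_less_lsqrt l_def intro!: power_strict_mono)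
      ultimately show ?thesis using below finite_subset by blast
    next
      case False
      then have "{b\<in>B. sqrt (l b) < t} = {}"
        using order_trans[OF less_imp_le norm_ge_zero] by (auto simp: l_def not_less not_le)
      then show ?thesis by (metis finite.emptyI)
    qed
  qed (use T B infB complete c0 in \<open>auto simp: l_def\<close>)
  then show ?thesis by (rule that)
qed

context diagonalized
begin

section \<open>Functional calculus in an eigenbasis\<close>

lemma norm_B: "b \<in> B \<Longrightarrow> norm b = 1"
  using B by (simp add: orthonormal_def)

lemmas cinner_B = orthonormal_cinner[OF B]

text \<open>Completeness of \<open>B\<close> reduces operator identities to identities between
  numbers, one for each basis vector; most of what follows is checked this way.\<close>

lemma vec_eqI: "(\<And>b. b \<in> B \<Longrightarrow> cinner x b = cinner y b) \<Longrightarrow> x = y"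
  using complete[of "x - y"] by (simp add: cinner_simps)

lemma expansion: "((\<lambda>b. cinner x b *\<^sub>C b) has_sum x) B"
proof -
  obtain y where y: "((\<lambda>b. cinner x b *\<^sub>C b) has_sum y) B" "\<And>b. b \<in> B \<Longrightarrow> cinner y b = cinner x b"
    using orthonormal_projection[OF B, of x] by metis
  then have "y = x" by (intro vec_eqI)
  then show ?thesis using y by simp
qed

lemma Parseval: "((\<lambda>b. cinner x b * cnj (cinner y b)) has_sum cinner x y) B"
proof -
  have "((\<lambda>b. cinner (cinner x b *\<^sub>C b) y) has_sum cinner x y) B"
    by (rule has_sum_cinner_left[OF expansion])
  then show ?thesis
    by (simp add: cinner_simps cinner_commute[symmetric])
qed

lemma cinner_cong:
  assumes "\<And>b. b \<in> B \<Longrightarrow> cinner x b * cnj (cinner y b) = cinner x' b * cnj (cinner y' b)"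
  shows "cinner x y = cinner x' y'"
proof (rule has_sum_unique)
  show "((\<lambda>b. cinner x b * cnj (cinner y b)) has_sum cinner x y) B" by (rule Parseval)
  show "((\<lambda>b. cinner x b * cnj (cinner y b)) has_sum cinner x' y') B"
    using Parseval[of x' y'] by (subst has_sum_cong[OF assms])
qed

lemma Parseval_norm: "((\<lambda>b. (cmod (cinner x b))\<^sup>2) has_sum (norm x)\<^sup>2) B"
proof -
  have "((\<lambda>b. Re (cinner x b * cnj (cinner x b))) has_sum Re (cinner x x)) B"
    by (rule has_sum_Re[OF Parseval])
  then show ?thesis
    by (simp only: complex_norm_square[symmetric] cinner_self Re_complex_of_real)
qed

definition bounded_symbol :: "('a \<Rightarrow> complex) \<Rightarrow> bool" where
  "bounded_symbol g \<longleftrightarrow> (\<exists>K. \<forall>b\<in>B. cmod (g b) \<le> K)"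

text \<open>Multiplication operator with symbol \<open>g\<close>. For a bounded symbol the vector
  chosen here exists by square summability and is unique by completeness.\<close>

definition diag :: "('a \<Rightarrow> complex) \<Rightarrow> 'a \<Rightarrow> 'a" where
  "diag g x = (SOME y. \<forall>b\<in>B. cinner y b = g b * cinner x b)"

lemma cinner_diag:
  assumes g: "bounded_symbol g" and b: "b \<in> B"
  shows "cinner (diag g x) b = g b * cinner x b"
proof -
  obtain K where K: "\<And>b. b \<in> B \<Longrightarrow> cmod (g b) \<le> K"
    using g by (auto simp: bounded_symbol_def)
  have "(\<Sum>b\<in>F. (cmod (g b * cinner x b))\<^sup>2) \<le> K\<^sup>2 * (norm x)\<^sup>2" if F: "finite F" "F \<subseteq> B" for F
  proof -
    have "(\<Sum>b\<in>F. (cmod (g b * cinner x b))\<^sup>2) \<le> (\<Sum>b\<in>F. K\<^sup>2 * (cmod (cinner x b))\<^sup>2)"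
      using F K by (intro sum_mono) (auto simp: norm_mult power_mult_distrib intro!: mult_right_mono power_mono)
    also have "\<dots> \<le> K\<^sup>2 * (norm x)\<^sup>2"
      unfolding sum_distrib_left[symmetric] using Bessel[OF B F] by (intro mult_left_mono) auto
    finally show ?thesis .
  qed
  from orthonormal_series[OF B this]
  obtain y where "\<And>b. b \<in> B \<Longrightarrow> cinner y b = g b * cinner x b"
    by metis
  then have "\<exists>y. \<forall>b\<in>B. cinner y b = g b * cinner x b" by blast
  then have "\<forall>b\<in>B. cinner (diag g x) b = g b * cinner x b"
    unfolding diag_def by (rule someI_ex)
  then show ?thesis using b by blast
qed

lemma diag_bounded_ops:
  assumes g: "bounded_symbol g"
  shows "diag g \<in> bounded_ops UNIV UNIV"
proof -
  obtain K where K: "\<And>b. b \<in> B \<Longrightarrow> cmod (g b) \<le> K"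
    using g by (auto simp: bounded_symbol_def)
  have K0: "0 \<le> K"
    using K infinite_imp_nonempty[OF infinite_B] norm_ge_zero order_trans by blast
  have "norm (diag g x) \<le> K * norm x" for x
  proof -
    have "(norm (diag g x))\<^sup>2 \<le> K\<^sup>2 * (norm x)\<^sup>2"
    proof (rule has_sum_mono)
      show "((\<lambda>b. (cmod (cinner (diag g x) b))\<^sup>2) has_sum (norm (diag g x))\<^sup>2) B"
        by (rule Parseval_norm)
      show "((\<lambda>b. K\<^sup>2 * (cmod (cinner x b))\<^sup>2) has_sum K\<^sup>2 * (norm x)\<^sup>2) B"
        by (rule has_sum_cmult_right[OF Parseval_norm])
      show "(cmod (cinner (diag g x) b))\<^sup>2 \<le> K\<^sup>2 * (cmod (cinner x b))\<^sup>2" if "b \<in> B" for b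
        using K[OF that] that
        by (auto simp: cinner_diag[OF g] norm_mult power_mult_distrib intro!: mult_right_mono power_mono)
    qed
    then have "(norm (diag g x))\<^sup>2 \<le> (K * norm x)\<^sup>2" by (simp add: power_mult_distrib)
    then show ?thesis by (rule power2_le_imp_le) (simp add: K0)
  qed
  moreover have "diag g (x + y) = diag g x + diag g y" for x y
    by (rule vec_eqI) (simp add: cinner_diag[OF g] cinner_simps ring_distribs)
  moreover have "diag g (c *\<^sub>C x) = c *\<^sub>C diag g x" for c x
    by (rule vec_eqI) (simp add: cinner_diag[OF g] cinner_simps)
  ultimately show ?thesis by (auto simp: bounded_ops_def)
qed

section \<open>The modulus of \<open>T\<close> in the eigenbasis\<close>

lemma norm_T_B: assumes "b \<in> B" shows "norm (T b) = \<mu> b"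
proof -
  have "(norm (T b))\<^sup>2 = (\<mu> b)\<^sup>2"
    using cinner_self_real(2)[of "T b"] T_eigen[OF assms, of b] assms
    by (simp add: cinner_B del: of_real_power)
  then show ?thesis using \<mu>_nonneg[OF assms] by simp
qed

lemma bounded_symbol_\<mu>: "bounded_symbol (\<lambda>b. complex_of_real (\<mu> b))"
proof -
  obtain K where "\<And>x. norm (T x) \<le> K * norm x"
    using bounded_ops_bound[OF T] by (metis UNIV_I)
  then have "cmod (complex_of_real (\<mu> b)) \<le> K" if "b \<in> B" for b
    using norm_T_B[OF that] norm_B[OF that] \<mu>_nonneg[OF that] by (metis abs_of_nonneg mult.right_neutral norm_of_real)
  then show ?thesis by (auto simp: bounded_symbol_def)
qed

lemma cinner_TT: "b \<in> B \<Longrightarrow> cinner (adj T (T x)) b = complex_of_real ((\<mu> b)\<^sup>2) * cinner x b"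
  using adj_spec[OF T, of b "T x"] T_eigen[of b x] by (metis cinner_commute)

text \<open>This carries the uniqueness of the positive square root. For m > 0 factor P^2 - m^2 as
  (P + m)(P - m): the vector y = P b - m b satisfies P y = - m y, which positivity forbids unless y
  = 0.\<close>

lemma positive_sqrt_eigenvector:
  assumes P: "P \<in> bounded_ops UNIV UNIV" "positive_on UNIV P"
    and PP: "P (P b) = complex_of_real (m\<^sup>2) *\<^sub>C b" and m: "0 \<le> m"
  shows "P b = complex_of_real m *\<^sub>C b"
proof -
  note lin = bounded_opsD(2,3)[OF P(1), simplified]
  have P0: "P 0 = 0" using lin(2)[of 0 0] by simp
  have pos: "cinner (P x) x \<in> \<real>\<^sub>\<ge>\<^sub>0" for x using P(2) by (simp add: positive_on_def)
  have Im0: "Im (cinner (P x) x) = 0" for x using pos[of x] by (simp add: complex_nonneg_Reals_iff)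
  show ?thesis
  proof (cases "m = 0")
    case True
    define w where "w = P b"
    have Pw: "P w = 0" using PP True by (simp add: w_def)
    \<comment> \<open>Positivity includes that the form is real. Here its value is
      \<open>cinner w (b + \<i> *\<^sub>C w)\<close>, whose imaginary part is that of
      \<open>cinner w b\<close>, namely 0, minus the square of \<open>norm w\<close>.\<close>
    have "P (b + \<i> *\<^sub>C w) = w" by (simp add: lin Pw flip: w_def)
    then have "Im (cinner w (b + \<i> *\<^sub>C w)) = 0" using Im0 by metis
    moreover have "Im (cinner w b) = 0" using Im0 w_def by metis
    ultimately have "Re (cinner w w) = 0" by (simp add: cinner_simps)
    then have "w = 0" by (simp add: cinner_self_real)
    then show ?thesis using True w_def by simp
  next
    case False
    define y where "y = P b + (- complex_of_real m) *\<^sub>C b"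
    have "P y = complex_of_real (m\<^sup>2) *\<^sub>C b + (- complex_of_real m) *\<^sub>C P b"
      by (simp only: y_def lin PP)
    also have "\<dots> = (- complex_of_real m) *\<^sub>C y"
      by (simp only: y_def scaleC_add_right scaleC_scaleC minus_mult_minus power2_eq_square of_real_mult add.commute)
    finally have "cinner (P y) y = complex_of_real (- m * (norm y)\<^sup>2)"
      by (simp add: cinner_simps cinner_self)
    then have "0 \<le> - m * (norm y)\<^sup>2" using pos[of y] by (metis complex_nonneg_Reals_iff Re_complex_of_real)
    then have "y = 0" using m False by (auto simp: mult_le_0_iff)
    then show ?thesis by (simp add: y_def)
  qed
qed

definition P :: "'a \<Rightarrow> 'a" where "P = diag (\<lambda>b. complex_of_real (\<mu> b))"

lemma P_bounded_ops: "P \<in> bounded_ops UNIV UNIV"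
  unfolding P_def by (rule diag_bounded_ops[OF bounded_symbol_\<mu>])

lemma cinner_P: "b \<in> B \<Longrightarrow> cinner (P x) b = complex_of_real (\<mu> b) * cinner x b"
  unfolding P_def by (rule cinner_diag[OF bounded_symbol_\<mu>])

lemma P_P: "P (P x) = adj T (T x)"
  by (rule vec_eqI) (simp add: cinner_P cinner_TT power2_eq_square)

text \<open>The definite description needs uniqueness: any positive root of
  \<open>adj T \<circ> T\<close> acts on each \<open>b\<close> as multiplication by
  \<open>\<mu> b\<close>, and continuity carries the agreement from \<open>B\<close> to the whole
  space.\<close>

lemma abs_op_eq: "abs_op T = P"
  unfolding abs_op_def op_sqrt_def
proof (rule the_equality)
  have "cinner (P x) x \<in> \<real>\<^sub>\<ge>\<^sub>0" for x
  proof -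
    have "((\<lambda>b. cinner (P x) b * cnj (cinner x b)) has_sum cinner (P x) x) B" by (rule Parseval)
    moreover have "cinner (P x) b * cnj (cinner x b) = complex_of_real (\<mu> b * (cmod (cinner x b))\<^sup>2)"
      if "b \<in> B" for b
      unfolding cinner_P[OF that] of_real_mult complex_norm_square by (simp add: mult.assoc)
    ultimately have s: "((\<lambda>b. complex_of_real (\<mu> b * (cmod (cinner x b))\<^sup>2)) has_sum cinner (P x) x) B"
      using has_sum_cong by (metis (no_types, lifting))
    have "0 \<le> Re (cinner (P x) x)"
      using has_sum_Re[OF s] by (rule has_sum_nonneg) (simp add: \<mu>_nonneg del: of_real_mult of_real_power)
    moreover have "Im (cinner (P x) x) = 0"
      using has_sum_Im[OF s] by (simp only: Im_complex_of_real) (metis has_sum_0_simp has_sum_unique)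
    ultimately show ?thesis by (simp add: complex_nonneg_Reals_iff)
  qed
  moreover have "P \<circ> P = adj T \<circ> T"
    by (simp add: fun_eq_iff P_P)
  ultimately show "P \<in> bounded_ops UNIV UNIV \<and> positive_on UNIV P \<and> P \<circ> P = adj T \<circ> T"
    using P_bounded_ops by (simp add: positive_on_def)
next
  fix R assume R: "R \<in> bounded_ops UNIV UNIV \<and> positive_on UNIV R \<and> R \<circ> R = adj T \<circ> T"
  have Rb: "R b = P b" if b: "b \<in> B" for b
  proof -
    have "R (R b) = adj T (T b)" using R by (metis comp_apply)
    also have "\<dots> = complex_of_real ((\<mu> b)\<^sup>2) *\<^sub>C b"
      using b by (intro vec_eqI) (simp add: cinner_TT cinner_simps cinner_B)
    finally have "R (R b) = complex_of_real ((\<mu> b)\<^sup>2) *\<^sub>C b" .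
    then have "R b = complex_of_real (\<mu> b) *\<^sub>C b"
      by (rule positive_sqrt_eigenvector[rotated 2]) (use R \<mu>_nonneg[OF b] in simp_all)
    also have "\<dots> = P b"
      using b by (intro vec_eqI) (simp add: cinner_P cinner_simps cinner_B)
    finally show ?thesis .
  qed
  show "R = P"
  proof
    fix x
    have R': "R \<in> bounded_ops UNIV UNIV" using R by simp
    have "((\<lambda>b. R (cinner x b *\<^sub>C b)) has_sum R x) B"
      by (rule has_sum_bounded_linear[OF bounded_ops_bounded_linear[OF R'] expansion])
    moreover have "((\<lambda>b. P (cinner x b *\<^sub>C b)) has_sum P x) B"
      by (rule has_sum_bounded_linear[OF bounded_ops_bounded_linear[OF P_bounded_ops] expansion])
    moreover have "R (cinner x b *\<^sub>C b) = P (cinner x b *\<^sub>C b)" if "b \<in> B" for b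
      using Rb[OF that] bounded_opsD(3)[OF R'] bounded_opsD(3)[OF P_bounded_ops] by simp
    ultimately show "R x = P x"
      using has_sum_cong has_sum_unique by (metis (no_types, lifting))
  qed
qed

section \<open>Spectral subspaces\<close>

text \<open>The closed span of \<open>B \<inter> C\<close>, described by vanishing coordinates so
  that membership is tested on basis vectors. \<open>C\<close> is usually a condition on
  \<open>\<mu>\<close>, which makes \<open>V C\<close> a spectral subspace of the modulus.\<close>

definition V :: "'a set \<Rightarrow> 'a set" where
  "V C = {x. \<forall>b\<in>B. b \<notin> C \<longrightarrow> cinner x b = 0}"

definition proj :: "'a set \<Rightarrow> 'a \<Rightarrow> 'a" where
  "proj C = diag (\<lambda>b. if b \<in> C then 1 else 0)"

lemma V_D: "x \<in> V C \<Longrightarrow> b \<in> B \<Longrightarrow> b \<notin> C \<Longrightarrow> cinner x b = 0"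
  by (simp add: V_def)

lemma closed_csubspace_V: "closed_csubspace (V C)"
proof -
  have "V C = {x. \<forall>y\<in>B - C. cinner x y = 0}" by (auto simp: V_def)
  then show ?thesis using closed_csubspace_orthogonal[of "B - C"] by (simp only:)
qed

lemma B_in_V: "b \<in> B \<Longrightarrow> b \<in> C \<Longrightarrow> b \<in> V C"
  by (auto simp: V_def cinner_B)

lemma V_mono: "C \<subseteq> D \<Longrightarrow> V C \<subseteq> V D"
  by (auto simp: V_def)

lemma V_cinner: 
  assumes "x \<in> V C" "y \<in> V D" "C \<inter> D = {}"
  shows "cinner x y = 0"
proof -
  have "cinner x y = cinner 0 y"
    using assms by (intro cinner_cong) (auto simp: V_def)
  then show ?thesis by simp
qed

lemma bounded_symbol_indicator: "bounded_symbol (\<lambda>b. if b \<in> C then 1 else 0)"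
  by (auto simp: bounded_symbol_def intro: exI[of _ 1])

lemma proj_bounded_ops: "proj C \<in> bounded_ops UNIV (V C)"
proof (rule bounded_ops_mono[where S=UNIV and R=UNIV])
  show "proj C x \<in> V C" for x
    by (auto simp: V_def proj_def cinner_diag[OF bounded_symbol_indicator])
qed (auto simp: proj_def intro: diag_bounded_ops bounded_symbol_indicator)

lemma proj_in_V: "proj C x \<in> V C"
  using bounded_opsD(1)[OF proj_bounded_ops] by simp

lemma cinner_proj: "b \<in> B \<Longrightarrow> cinner (proj C x) b = (if b \<in> C then cinner x b else 0)"
  by (simp add: proj_def cinner_diag[OF bounded_symbol_indicator])

lemma proj_cinner_left: "cinner (proj C x) y = cinner x y" if "y \<in> V C"
  using that by (intro cinner_cong) (auto simp: cinner_proj V_def)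

lemma proj_cinner_right: "cinner y (proj C x) = cinner y x" if "y \<in> V C"
  using that by (intro cinner_cong) (auto simp: cinner_proj V_def)

lemma V_expansion:
  assumes "x \<in> V C" shows "((\<lambda>b. cinner x b *\<^sub>C b) has_sum x) (B \<inter> C)"
proof (subst has_sum_cong_neutral)
  show "((\<lambda>b. cinner x b *\<^sub>C b) has_sum x) B" by (rule expansion)
qed (use assms in \<open>auto simp: V_def\<close>)

lemma V_finite_sum:
  assumes "x \<in> V C" "finite (B \<inter> C)" shows "x = (\<Sum>b\<in>B \<inter> C. cinner x b *\<^sub>C b)"
  using V_expansion[OF assms(1)] has_sum_finite[OF assms(2)] by (rule has_sum_unique)

lemma V_subset_span:
  assumes fin: "finite (B \<inter> C)" shows "V C \<subseteq> complex_vector.span (B \<inter> C)"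
proof
  fix x assume x: "x \<in> V C"
  show "x \<in> complex_vector.span (B \<inter> C)"
    by (subst V_finite_sum[OF x fin])
      (intro complex_vector.span_sum complex_vector.span_scale complex_vector.span_base)
qed

lemma cfinite_dim_V_iff: "cfinite_dim (V C) \<longleftrightarrow> finite (B \<inter> C)"
proof
  assume "cfinite_dim (V C)"
  then show "finite (B \<inter> C)"
    using orthonormal_subset[OF B] by (rule cfinite_dim_orthonormal) (auto intro: B_in_V)
next
  assume fin: "finite (B \<inter> C)"
  then show "cfinite_dim (V C)" using V_subset_span unfolding cfinite_dim_def by blast
qed

lemma abs_eigenspace_eq: "abs_eigenspace T t = V {b. \<mu> b = t}"
proof -
  have "P x - complex_of_real t *\<^sub>C x = 0 \<longleftrightarrow> x \<in> V {b. \<mu> b = t}" for x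
  proof
    assume *: "P x - complex_of_real t *\<^sub>C x = 0"
    have "cinner x b = 0" if b: "b \<in> B" "\<mu> b \<noteq> t" for b
    proof -
      have "cinner (P x - complex_of_real t *\<^sub>C x) b = 0" by (simp add: *)
      then have "complex_of_real (\<mu> b - t) * cinner x b = 0"
        using b by (simp add: cinner_simps cinner_P ring_distribs)
      then show ?thesis using b by (simp del: of_real_diff)
    qed
    then show "x \<in> V {b. \<mu> b = t}" by (auto simp: V_def)
  next
    assume "x \<in> V {b. \<mu> b = t}"
    then show "P x - complex_of_real t *\<^sub>C x = 0"
      by (intro vec_eqI) (auto simp: cinner_simps cinner_P V_def)
  qed
  then show ?thesis by (auto simp: abs_eigenspace_def null_space_def op_shift_def abs_op_eq)
qed

lemma TT_eigen: "x \<in> V {b. \<mu> b = t} \<Longrightarrow> adj T (T x) = complex_of_real (t\<^sup>2) *\<^sub>C x"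
  by (rule vec_eqI) (auto simp: cinner_TT cinner_simps V_def)

text \<open>Source of the isometry on \<open>H1\<close>, of the unitary blocks and of the
  orthogonality of \<open>A\<close> to the range of \<open>V1\<close>: on an eigenspace of the
  modulus, \<open>T\<close> divided by a nonzero \<open>t\<close> preserves inner products.\<close>

lemma T_cinner_eigen: "x \<in> V {b. \<mu> b = t} \<Longrightarrow> cinner (T x) (T y) = complex_of_real (t\<^sup>2) * cinner x y"
  by (metis TT_eigen adj_spec[OF T] cinner_commute cinner_scaleC_left complex_cnj_cnj)

lemma norm_T_eigen: 
  assumes "x \<in> V {b. \<mu> b = t}" "0 \<le> t" shows "norm (T x) = t * norm x"
proof -
  have "complex_of_real ((norm (T x))\<^sup>2) = complex_of_real ((t * norm x)\<^sup>2)"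
    unfolding cinner_self[symmetric] T_cinner_eigen[OF assms(1)]
    by (simp add: cinner_self power_mult_distrib)
  then have "(norm (T x))\<^sup>2 = (t * norm x)\<^sup>2" using of_real_eq_iff by blast
  then show ?thesis using assms(2) by simp
qed

section \<open>The spectrum of the modulus\<close>

text \<open>Away from \<open>\<beta>\<close> the eigenvalues do not accumulate: a disc around
  \<open>z\<close> that stays at a distance from \<open>\<beta>\<close> meets only finitely many of
  them, counted with multiplicity.\<close>

lemma spectral_gap:
  assumes "z \<noteq> complex_of_real \<beta>"
  obtains \<delta> where "\<delta> > 0" "\<And>b. b \<in> B \<Longrightarrow> complex_of_real (\<mu> b) = z \<or> \<delta> \<le> cmod (complex_of_real (\<mu> b) - z)"
    "finite {b\<in>B. complex_of_real (\<mu> b) = z}"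
proof -
  \<comment> \<open>Half the distance to \<open>\<beta>\<close>: eigenvalues within
    \<open>\<epsilon>\<close> of \<open>z\<close> then differ from \<open>\<beta>\<close> by more
    than \<open>\<epsilon>\<close>, and the two finiteness conditions apply.\<close>
  define \<epsilon> where "\<epsilon> = cmod (z - complex_of_real \<beta>) / 2"
  have \<epsilon>: "\<epsilon> > 0" using assms by (simp add: \<epsilon>_def)
  define F where "F = {b\<in>B. cmod (complex_of_real (\<mu> b) - z) < \<epsilon>}"
  have "F \<subseteq> {b\<in>B. \<mu> b > \<beta>} \<union> {b\<in>B. \<mu> b < \<beta> - \<epsilon> / 2}"
  proof
    fix b assume b: "b \<in> F"
    have "2 * \<epsilon> \<le> cmod (complex_of_real (\<mu> b) - z) + cmod (complex_of_real (\<mu> b - \<beta>))"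
      using norm_triangle_ineq[of "z - complex_of_real (\<mu> b)" "complex_of_real (\<mu> b - \<beta>)"]
      by (simp add: \<epsilon>_def norm_minus_commute)
    then have "\<epsilon> < \<bar>\<mu> b - \<beta>\<bar>" using b by (simp add: F_def del: of_real_diff)
    then show "b \<in> {b\<in>B. \<mu> b > \<beta>} \<union> {b\<in>B. \<mu> b < \<beta> - \<epsilon> / 2}"
      using b \<epsilon> by (auto simp: F_def abs_if split: if_splits)
  qed
  then have fin: "finite F"
    by (rule finite_subset) (use finite_above finite_below[of "\<beta> - \<epsilon> / 2"] \<epsilon> in simp)
  define D where "D = (\<lambda>b. cmod (complex_of_real (\<mu> b) - z)) ` {b\<in>F. complex_of_real (\<mu> b) \<noteq> z}"
  define \<delta> where "\<delta> = Min (insert \<epsilon> D)"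
  have finD: "finite D" using fin by (simp add: D_def)
  show ?thesis
  proof (rule that[of \<delta>])
    show "\<delta> > 0" unfolding \<delta>_def using finD \<epsilon> by (subst Min_gr_iff) (auto simp: D_def)
    show "complex_of_real (\<mu> b) = z \<or> \<delta> \<le> cmod (complex_of_real (\<mu> b) - z)" if "b \<in> B" for b
    proof (cases "b \<in> F")
      case True
      then have "complex_of_real (\<mu> b) = z \<or> cmod (complex_of_real (\<mu> b) - z) \<in> insert \<epsilon> D"
        by (auto simp: D_def)
      then show ?thesis unfolding \<delta>_def using finD Min_le[of "insert \<epsilon> D"] by blast
    next
      case False
      then have "\<epsilon> \<le> cmod (complex_of_real (\<mu> b) - z)" using that by (auto simp: F_def)
      moreover have "\<delta> \<le> \<epsilon>" using finD by (simp add: \<delta>_def)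
      ultimately show ?thesis by simp
    qed
    show "finite {b\<in>B. complex_of_real (\<mu> b) = z}"
      using fin by (rule finite_subset[rotated]) (use \<epsilon> in \<open>auto simp: F_def\<close>)
  qed
qed

lemma cinner_shift: "b \<in> B \<Longrightarrow> cinner (op_shift P z x) b = (complex_of_real (\<mu> b) - z) * cinner x b"
  by (simp add: op_shift_def cinner_simps cinner_P ring_distribs)

lemma op_shift_bounded_ops: "op_shift P z \<in> bounded_ops UNIV UNIV"
proof -
  obtain K where "\<And>b. b \<in> B \<Longrightarrow> cmod (complex_of_real (\<mu> b)) \<le> K"
    using bounded_symbol_\<mu> by (auto simp: bounded_symbol_def)
  then have "\<forall>b\<in>B. cmod (complex_of_real (\<mu> b) - z) \<le> K + cmod z"
    using norm_triangle_ineq4 by (metis add_right_mono order_trans)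
  then have sym: "bounded_symbol (\<lambda>b. complex_of_real (\<mu> b) - z)"
    unfolding bounded_symbol_def by blast
  have "op_shift P z x = diag (\<lambda>b. complex_of_real (\<mu> b) - z) x" for x
    by (rule vec_eqI) (simp add: cinner_shift cinner_diag[OF sym])
  then have "op_shift P z = diag (\<lambda>b. complex_of_real (\<mu> b) - z)" by blast
  then show ?thesis using diag_bounded_ops[OF sym] by simp
qed

text \<open>Inverse of \<open>P - z\<close> off the eigenspace, extended by zero on it; the spectral
  gap makes it bounded. It serves as the resolvent when \<open>z\<close> is no eigenvalue and as a
  generalized inverse in the Fredholm argument.\<close>

lemma partial_inverse:
  assumes "z \<noteq> complex_of_real \<beta>"
  obtains R where "R \<in> bounded_ops UNIV UNIV"
    "\<And>x b. b \<in> B \<Longrightarrow> cinner (R x) b = (if complex_of_real (\<mu> b) = z then 0 else cinner x b / (complex_of_real (\<mu> b) - z))"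
proof -
  obtain \<delta> where \<delta>: "\<delta> > 0" "\<And>b. b \<in> B \<Longrightarrow> complex_of_real (\<mu> b) = z \<or> \<delta> \<le> cmod (complex_of_real (\<mu> b) - z)"
    using spectral_gap[OF assms] by metis
  define g where "g b = (if complex_of_real (\<mu> b) = z then 0 else 1 / (complex_of_real (\<mu> b) - z))" for b
  have "cmod (g b) \<le> 1 / \<delta>" if "b \<in> B" for b
    using \<delta>(1) \<delta>(2)[OF that] by (auto simp: g_def norm_divide frac_le)
  then have sym: "bounded_symbol g" by (auto simp: bounded_symbol_def)
  show ?thesis
    by (rule that[of "diag g"]) (auto simp: diag_bounded_ops[OF sym] cinner_diag[OF sym] g_def)
qed

lemma op_spectrum_eigenvalue: assumes "b \<in> B" shows "complex_of_real (\<mu> b) \<in> op_spectrum (abs_op T)"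
proof -
  have "op_shift P (complex_of_real (\<mu> b)) b = 0"
    using assms by (intro vec_eqI) (simp add: cinner_shift cinner_B)
  moreover have "R 0 = 0" if "R \<in> bounded_ops UNIV UNIV" for R :: "'a \<Rightarrow> 'a"
    using bounded_ops_zero[OF that closed_csubspace_UNIV] .
  moreover have "b \<noteq> 0" using norm_B[OF assms] by auto
  ultimately have "\<not> (\<exists>R\<in>bounded_ops UNIV UNIV. R \<circ> op_shift P (complex_of_real (\<mu> b)) = id \<and>
      op_shift P (complex_of_real (\<mu> b)) \<circ> R = id)"
    by (metis comp_apply id_apply)
  then show ?thesis by (simp add: op_spectrum_def abs_op_eq)
qed

text \<open>The point \<open>\<beta>\<close> is left out because it may be a limit of eigenvalues
  without being one.\<close>

lemma op_spectrum_imp_eigenvalue: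
  assumes "z \<in> op_spectrum (abs_op T)" "z \<noteq> complex_of_real \<beta>"
  shows "\<exists>b\<in>B. z = complex_of_real (\<mu> b)"
proof (rule ccontr)
  assume "\<not> ?thesis"
  then have no: "\<And>b. b \<in> B \<Longrightarrow> complex_of_real (\<mu> b) \<noteq> z" by auto
  obtain R where R: "R \<in> bounded_ops UNIV UNIV"
    "\<And>x b. b \<in> B \<Longrightarrow> cinner (R x) b = (if complex_of_real (\<mu> b) = z then 0 else cinner x b / (complex_of_real (\<mu> b) - z))"
    using partial_inverse[OF assms(2)] by metis
  have "R \<circ> op_shift P z = id" "op_shift P z \<circ> R = id"
    using no by (auto intro!: ext vec_eqI simp: R(2) cinner_shift)
  then show False using assms(1) R(1) by (auto simp: op_spectrum_def abs_op_eq)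
qed

lemma adj_shift: "adj (op_shift P z) = op_shift P (cnj z)"
proof
  fix y
  show "adj (op_shift P z) y = op_shift P (cnj z) y"
    by (rule adj_on_eqI) (auto intro!: cinner_cong simp: cinner_shift)
qed

lemma null_space_shift: "null_space (op_shift P z) = V {b. complex_of_real (\<mu> b) = z}"
proof -
  have "op_shift P z x = 0 \<longleftrightarrow> (\<forall>b\<in>B. cinner (op_shift P z x) b = 0)" for x
    using complete by (metis cinner_zero_left)
  then show ?thesis by (auto simp: null_space_def cinner_shift V_def)
qed

text \<open>The generalized inverse identifies the range with the orthogonal complement of the
  kernel, which is closed; the spectral gap gives finite multiplicity.\<close>

lemma fredholm_shift:
  assumes "z \<noteq> complex_of_real \<beta>" shows "fredholm (op_shift P z)"
proof -
  have fin: "finite (B \<inter> {b. complex_of_real (\<mu> b) = w})" if w: "w \<noteq> complex_of_real \<beta>" for w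
    using spectral_gap[OF w] by (metis Collect_conj_eq Collect_mem_eq)
  have "cnj z \<noteq> complex_of_real \<beta>"
    using assms by (metis complex_cnj_cnj complex_cnj_complex_of_real)
  then have dim: "cfinite_dim (null_space (op_shift P z))" "cfinite_dim (null_space (adj (op_shift P z)))"
    using fin assms by (simp_all add: null_space_shift adj_shift cfinite_dim_V_iff)
  obtain R where R: "R \<in> bounded_ops UNIV UNIV"
    "\<And>x b. b \<in> B \<Longrightarrow> cinner (R x) b = (if complex_of_real (\<mu> b) = z then 0 else cinner x b / (complex_of_real (\<mu> b) - z))"
    using partial_inverse[OF assms] by metis
  have "range (op_shift P z) = V {b. complex_of_real (\<mu> b) \<noteq> z}"
  proof
    show "range (op_shift P z) \<subseteq> V {b. complex_of_real (\<mu> b) \<noteq> z}"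
      by (auto simp: V_def cinner_shift)
    show "V {b. complex_of_real (\<mu> b) \<noteq> z} \<subseteq> range (op_shift P z)"
    proof
      fix x assume x: "x \<in> V {b. complex_of_real (\<mu> b) \<noteq> z}"
      have "x = op_shift P z (R x)"
        using x by (intro vec_eqI) (auto simp: cinner_shift R(2) V_def)
      then show "x \<in> range (op_shift P z)" by blast
    qed
  qed
  then show ?thesis
    using dim closed_csubspaceD(2)[OF closed_csubspace_V] by (simp add: fredholm_def)
qed

text \<open>If \<open>\<beta>\<close> has finite multiplicity, it is an accumulation point of other eigenvalues, so the
  inverse of \<open>P - \<beta>\<close> off its kernel is unbounded and the range is not closed.\<close>

lemma not_fredholm_shift: "\<not> fredholm (op_shift P (complex_of_real \<beta>))"
proof
  let ?S = "op_shift P (complex_of_real \<beta>)"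
  assume fr: "fredholm ?S"
  then have "finite (B \<inter> {b. \<mu> b = \<beta>})"
    by (simp add: fredholm_def null_space_shift cfinite_dim_V_iff)
  then have near: "\<exists>b\<in>B. \<mu> b \<noteq> \<beta> \<and> \<bar>\<mu> b - \<beta>\<bar> < d" if "d > 0" for d
  proof -
    have "finite ((B \<inter> {b. \<mu> b = \<beta>}) \<union> {b\<in>B. \<mu> b > \<beta>} \<union> {b\<in>B. \<mu> b < \<beta> - d / 2})"
      using \<open>finite (B \<inter> {b. \<mu> b = \<beta>})\<close> finite_above finite_below[of "\<beta> - d / 2"] \<open>d > 0\<close> by simp
    then have "infinite (B - ((B \<inter> {b. \<mu> b = \<beta>}) \<union> {b\<in>B. \<mu> b > \<beta>} \<union> {b\<in>B. \<mu> b < \<beta> - d / 2}))"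
      using infinite_B by (rule Diff_infinite_finite)
    from infinite_imp_nonempty[OF this] obtain b where "b \<in> B" "\<mu> b \<noteq> \<beta>" "\<not> \<mu> b > \<beta>" "\<not> \<mu> b < \<beta> - d / 2"
      by blast
    then show ?thesis using \<open>d > 0\<close> by (intro bexI[of _ b]) auto
  qed
  define d where "d b = \<bar>\<mu> b - \<beta>\<bar>" for b
  \<comment> \<open>Distances to \<open>\<beta>\<close> more than halve at each step, so the images
    of the \<open>s n\<close> under \<open>P - \<beta>\<close> form a norm-convergent series. Its
    partial sums lie in the range, hence so would its sum.\<close>
  have "\<exists>s. \<forall>n::nat. (s n \<in> B \<and> \<mu> (s n) \<noteq> \<beta>) \<and> d (s (Suc n)) < d (s n) / 2"
  proof (rule dependent_nat_choice)
    show "\<exists>b. b \<in> B \<and> \<mu> b \<noteq> \<beta>" using near[of 1] by auto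
    fix b and n :: nat assume "b \<in> B \<and> \<mu> b \<noteq> \<beta>"
    then have "d b / 2 > 0" by (simp add: d_def)
    from near[OF this] show "\<exists>b'. (b' \<in> B \<and> \<mu> b' \<noteq> \<beta>) \<and> d b' < d b / 2"
      unfolding d_def by blast
  qed
  then obtain s where s: "\<And>n. s n \<in> B" "\<And>n. \<mu> (s n) \<noteq> \<beta>" "\<And>n. d (s (Suc n)) < d (s n) / 2"
    by blast
  have "d (s (Suc n)) < d (s n)" for n
    using s(3)[of n] d_def[of "s n"] by linarith
  then have "d (s j) < d (s i)" if "i < j" for i j
    using lift_Suc_mono_less[of "\<lambda>n. - d (s n)", OF _ that] by simp
  then have inj: "inj s"
    by (metis injI less_irrefl linorder_neqE_nat)
  define f where "f n = ?S (s n)" for n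
  have f_eq: "f n = complex_of_real (\<mu> (s n) - \<beta>) *\<^sub>C s n" for n
    using s(1) by (intro vec_eqI) (auto simp: f_def cinner_shift cinner_simps cinner_B)
  have norm_f: "norm (f n) = d (s n)" for n
    using norm_B[OF s(1)] by (simp add: f_eq d_def del: of_real_diff)
  have "d (s n) \<le> d (s 0) * (1/2) ^ n" for n
  proof (induction n)
    case (Suc n)
    then show ?case using s(3)[of n] by simp
  qed simp
  then have "norm (f n) \<le> d (s 0) * (1/2) ^ n" for n
    by (simp add: norm_f)
  moreover have "summable (\<lambda>n. d (s 0) * (1/2) ^ n)"
    by (rule summable_mult) (simp add: summable_geometric)
  ultimately have "summable f"
    by (metis summable_comparison_test')
  then have y: "f sums suminf f" by (rule summable_sums)
  have "(\<Sum>n<N. f n) = ?S (\<Sum>n<N. s n)" for N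
    using bounded_ops_sum[OF op_shift_bounded_ops closed_csubspace_UNIV, of "{..<N}" s] by (simp add: f_def)
  then have "\<forall>N. (\<Sum>n<N. f n) \<in> range ?S" by simp
  moreover have "closed (range ?S)" using fr by (simp add: fredholm_def)
  ultimately have "suminf f \<in> range ?S"
    using y unfolding sums_def by (meson closed_sequentially)
  then obtain x where x: "suminf f = ?S x" by blast
  \<comment> \<open>A preimage of the sum would have coordinate 1 at infinitely many orthonormal
    vectors, against Bessel.\<close>
  have "cinner x (s k) = 1" for k
  proof -
    have "(\<lambda>n. cinner (f n) (s k)) sums cinner (?S x) (s k)"
      using bounded_linear.sums[OF bounded_linear_cinner_left y] x by simp
    moreover have "cinner (f n) (s k) = (if n = k then complex_of_real (\<mu> (s k) - \<beta>) else 0)" for n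
      using inj by (auto simp: f_eq cinner_simps cinner_B s(1) inj_eq)
    then have "(\<lambda>n. cinner (f n) (s k)) sums complex_of_real (\<mu> (s k) - \<beta>)"
      using sums_single[of k "\<lambda>k. complex_of_real (\<mu> (s k) - \<beta>)"] by (simp only:) (simp add: eq_commute cong: if_cong)
    ultimately have "complex_of_real (\<mu> (s k) - \<beta>) * cinner x (s k) = complex_of_real (\<mu> (s k) - \<beta>)"
      using sums_unique2 s(1) by (metis cinner_shift of_real_diff)
    then show ?thesis using s(2)[of k] by (simp del: of_real_diff)
  qed
  then have "real N \<le> (norm x)\<^sup>2" for N
    using Bessel[OF B, of "s ` {..<N}" x] s(1) inj by (simp add: image_subset_iff sum.reindex inj_on_subset)
  then show False using real_arch_simple reals_Archimedean2 linorder_not_le by blast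
qed

lemma ess_spectrum_eq: "ess_spectrum (abs_op T) = {complex_of_real \<beta>}"
  using fredholm_shift not_fredholm_shift by (auto simp: ess_spectrum_def abs_op_eq)

section \<open>Orthogonal sums of eigenspaces\<close>

text \<open>The expansion in \<open>B\<close> is regrouped by eigenvalue, as a sum over pairs of an
  index and a basis vector. That \<open>C\<close> depends on \<open>b\<close> only through
  \<open>\<mu> b\<close> keeps eigenspaces from being split; injectivity of \<open>v\<close> makes
  each basis vector occur once.\<close>

lemma V_has_sum_eigenspaces:
  assumes v: "inj_on v I" "v ` I = \<mu> ` (B \<inter> C)" and C: "C = {b. \<mu> b \<in> S}" and x: "x \<in> V C"
  shows "((\<lambda>i. proj {b. \<mu> b = v i} x) has_sum x) I"
proof (rule has_sum_Sigma)
  let ?D = "\<lambda>i. B \<inter> {b. \<mu> b = v i}"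
  show "uniformly_continuous_on UNIV (\<lambda>(x::'a, y). x + y)"
    by (rule isUCont_plus)
  show "((\<lambda>b. (case (i, b) of (i, b) \<Rightarrow> cinner x b *\<^sub>C b)) has_sum proj {b. \<mu> b = v i} x) (?D i)" for i
  proof -
    have "((\<lambda>b. cinner (proj {b. \<mu> b = v i} x) b *\<^sub>C b) has_sum proj {b. \<mu> b = v i} x) (?D i)"
      by (rule V_expansion[OF proj_in_V])
    then show ?thesis by (subst (asm) has_sum_cong[where g="\<lambda>b. cinner x b *\<^sub>C b"]) (auto simp: cinner_proj)
  qed
  have "snd ` Sigma I ?D = B \<inter> C"
  proof
    show "snd ` Sigma I ?D \<subseteq> B \<inter> C"
      using v(2) C by (auto simp: image_iff) (metis IntE image_iff imageI mem_Collect_eq)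
    show "B \<inter> C \<subseteq> snd ` Sigma I ?D"
    proof
      fix b assume b: "b \<in> B \<inter> C"
      then obtain i where "i \<in> I" "v i = \<mu> b" using v(2) by (metis imageE imageI)
      then have "(i, b) \<in> Sigma I ?D" using b by auto
      then show "b \<in> snd ` Sigma I ?D" by force
    qed
  qed
  then have "((\<lambda>b. cinner x b *\<^sub>C b) has_sum x) (snd ` Sigma I ?D)"
    using V_expansion[OF x] by simp
  moreover have "inj_on snd (Sigma I ?D)"
    using v(1) by (auto simp: inj_on_def)
  ultimately have "((\<lambda>b. cinner x b *\<^sub>C b) \<circ> snd has_sum x) (Sigma I ?D)"
    by (simp only: has_sum_reindex)
  then show "((\<lambda>(i, b). cinner x b *\<^sub>C b) has_sum x) (Sigma I ?D)"
    by (simp add: comp_def case_prod_unfold)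
qed

lemma hilbert_sum_eigenspaces:
  assumes v: "inj_on v I" "v ` I = \<mu> ` (B \<inter> C)" and C: "C = {b. \<mu> b \<in> S}"
  shows "hilbert_sum I (\<lambda>i. abs_eigenspace T (v i)) = V C"
proof
  show "V C \<subseteq> hilbert_sum I (\<lambda>i. abs_eigenspace T (v i))"
  proof
    fix x assume "x \<in> V C"
    from V_has_sum_eigenspaces[OF v C this] show "x \<in> hilbert_sum I (\<lambda>i. abs_eigenspace T (v i))"
      unfolding hilbert_sum_def abs_eigenspace_eq
      by (intro CollectI exI[of _ "\<lambda>i. proj {b. \<mu> b = v i} x"] conjI ballI proj_in_V)
  qed
  have "abs_eigenspace T (v i) \<subseteq> V C" if "i \<in> I" for i
  proof -
    have "v i \<in> S" using v(2) that C by (metis IntE imageE imageI mem_Collect_eq)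
    then show ?thesis unfolding abs_eigenspace_eq C by (intro V_mono) auto
  qed
  then show "hilbert_sum I (\<lambda>i. abs_eigenspace T (v i)) \<subseteq> V C"
    unfolding hilbert_sum_def by (auto elim!: closed_csubspace_has_sum[OF closed_csubspace_V])
qed

lemma orthogonal_family_eigenspaces:
  assumes "inj_on v I" shows "orthogonal_family I (\<lambda>i. abs_eigenspace T (v i))"
  unfolding orthogonal_family_def corthogonal_def abs_eigenspace_eq
proof (intro conjI ballI impI closed_csubspace_V)
  fix i j x y assume "i \<in> I" "j \<in> I" "i \<noteq> j" and xy: "x \<in> V {b. \<mu> b = v i}" "y \<in> V {b. \<mu> b = v j}"
  then have "v i \<noteq> v j" using assms by (auto simp: inj_on_def)
  then show "cinner x y = 0" by (intro V_cinner[OF xy]) auto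
qed

text \<open>Comparison with one bounded operator \<open>W\<close> on the ambient space: its
  continuity forces the value \<open>W x\<close> for every admissible decomposition of
  \<open>x\<close>, so the definite description is met without comparing decompositions.\<close>

lemma direct_sum_op_eigenspaces:
  assumes v: "inj_on v I" "v ` I = \<mu> ` (B \<inter> C)" and C: "C = {b. \<mu> b \<in> S}" and x: "x \<in> V C"
    and W: "bounded_linear W" "\<And>i u. i \<in> I \<Longrightarrow> u \<in> abs_eigenspace T (v i) \<Longrightarrow> W u = D i u"
  shows "direct_sum_op I (\<lambda>i. abs_eigenspace T (v i)) D x = W x"
  unfolding direct_sum_op_def
proof (rule the_equality)
  let ?p = "\<lambda>i. proj {b. \<mu> b = v i} x"
  have "((\<lambda>i. W (?p i)) has_sum W x) I"
    by (rule has_sum_bounded_linear[OF W(1) V_has_sum_eigenspaces[OF v C x]])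
  then have "((\<lambda>i. D i (?p i)) has_sum W x) I"
    using W(2)[OF _ proj_in_V[of "{b. \<mu> b = v _}" x, folded abs_eigenspace_eq]]
    by (subst has_sum_cong[where g="\<lambda>i. W (?p i)"]) auto
  then show "\<exists>f. (\<forall>i\<in>I. f i \<in> abs_eigenspace T (v i)) \<and> (f has_sum x) I \<and> ((\<lambda>i. D i (f i)) has_sum W x) I"
    using V_has_sum_eigenspaces[OF v C x] unfolding abs_eigenspace_eq
    by (intro exI[of _ ?p] conjI ballI proj_in_V)
next
  fix y assume "\<exists>f. (\<forall>i\<in>I. f i \<in> abs_eigenspace T (v i)) \<and> (f has_sum x) I \<and> ((\<lambda>i. D i (f i)) has_sum y) I"
  then obtain f where f: "\<And>i. i \<in> I \<Longrightarrow> f i \<in> abs_eigenspace T (v i)" "(f has_sum x) I"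
    "((\<lambda>i. D i (f i)) has_sum y) I" by blast
  have "((\<lambda>i. W (f i)) has_sum W x) I"
    by (rule has_sum_bounded_linear[OF W(1) f(2)])
  then have "((\<lambda>i. D i (f i)) has_sum W x) I"
    using W(2)[OF _ f(1)] by (subst has_sum_cong[where g="\<lambda>i. W (f i)"]) auto
  then show "y = W x" using f(3) has_sum_unique by blast
qed

end

section \<open>Hyponormality\<close>

lemma hyponormal_norm_le:
  fixes T :: "'a::chilbert_space \<Rightarrow> 'a"
  assumes T: "T \<in> bounded_ops UNIV UNIV" and hyp: "hyponormal T"
  shows "norm (adj T x) \<le> norm (T x)"
proof -
  have "cinner (adj T (T x)) x = cinner (T x) (T x)"
    using adj_spec[OF T, of x "T x"] by (metis cinner_commute)
  then have "cinner (adj T (T x) - T (adj T x)) x = complex_of_real ((norm (T x))\<^sup>2 - (norm (adj T x))\<^sup>2)"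
    using adj_spec[OF T, of "adj T x" x] by (simp add: cinner_diff_left cinner_self)
  moreover have "cinner (adj T (T x) - T (adj T x)) x \<in> \<real>\<^sub>\<ge>\<^sub>0"
    using hyp by (simp add: hyponormal_def positive_on_def)
  ultimately have "(norm (adj T x))\<^sup>2 \<le> (norm (T x))\<^sup>2"
    by (metis complex_nonneg_Reals_iff Re_complex_of_real diff_ge_0_iff_ge)
  then show ?thesis by (rule power2_le_imp_le) simp
qed

section \<open>Reducing eigenspaces above \<beta>\<close>

context diagonalized
begin

interpretation T: bounded_linear T
  using T by (rule bounded_ops_bounded_linear)

text \<open>On \<open>V {b. \<mu> b \<le> t}\<close> the operator t^2 - |T|^2 is positive; its
  square root maps \<open>y\<close> to a vector \<open>w\<close> whose squared norm is t^2 |y|^2 -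
  |T y|^2. The growth hypothesis forces \<open>w = 0\<close>, so \<open>y\<close> has no coordinates
  with \<open>\<mu> b < t\<close>.\<close>

lemma V_maximal_growth:
  assumes y: "y \<in> V {b. \<mu> b \<le> t}" and t: "0 \<le> t" and le: "t * norm y \<le> norm (T y)"
  shows "y \<in> V {b. \<mu> b = t}"
proof -
  \<comment> \<open>Symbol of the square root, set to 0 above \<open>t\<close>, where the radicand
    would be negative and \<open>y\<close> has no coordinates.\<close>
  define g where "g b = (if \<mu> b \<le> t then complex_of_real (sqrt (t\<^sup>2 - (\<mu> b)\<^sup>2)) else 0)" for b
  have "cmod (g b) \<le> t" if "b \<in> B" for b
  proof (cases "\<mu> b \<le> t")
    case True
    have "(\<mu> b)\<^sup>2 \<le> t\<^sup>2" using True \<mu>_nonneg[OF that] by (intro power_mono)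
    moreover have "sqrt (t\<^sup>2 - (\<mu> b)\<^sup>2) \<le> sqrt (t\<^sup>2)" by (intro real_sqrt_le_mono) simp
    ultimately show ?thesis using True t by (simp add: g_def)
  qed (simp add: g_def t)
  then have sym: "bounded_symbol g" by (auto simp: bounded_symbol_def)
  have gg: "g b * g b = complex_of_real (t\<^sup>2 - (\<mu> b)\<^sup>2)" if "b \<in> B" "\<mu> b \<le> t" for b
    using power_mono[OF that(2) \<mu>_nonneg[OF that(1)], of 2] that(2)
    by (simp add: g_def del: of_real_diff of_real_power flip: of_real_mult)
  have cnj_g: "cnj (g b) = g b" for b by (simp add: g_def)
  define w where "w = diag g y"
  have "cinner w w = cinner (complex_of_real (t\<^sup>2) *\<^sub>C y - adj T (T y)) y"
  proof (rule cinner_cong)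
    fix b assume b: "b \<in> B"
    show "cinner w b * cnj (cinner w b) =
        cinner (complex_of_real (t\<^sup>2) *\<^sub>C y - adj T (T y)) b * cnj (cinner y b)"
    proof (cases "\<mu> b \<le> t")
      case True
      have "cinner w b * cnj (cinner w b) = (g b * g b) * (cinner y b * cnj (cinner y b))"
        by (simp add: w_def cinner_diag[OF sym b] cnj_g)
      then show ?thesis
        using b True by (simp add: gg cinner_simps cinner_TT algebra_simps)
    next
      case False
      then have "cinner y b = 0" using y b by (auto simp: V_def)
      then show ?thesis by (simp add: w_def cinner_diag[OF sym b])
    qed
  qed
  also have "\<dots> = complex_of_real ((t * norm y)\<^sup>2 - (norm (T y))\<^sup>2)"
  proof -
    have "cinner (adj T (T y)) y = cinner (T y) (T y)"
      using adj_spec[OF T, of y "T y"] by (metis cinner_commute)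
    then show ?thesis by (simp add: cinner_simps cinner_self power_mult_distrib)
  qed
  finally have "(norm w)\<^sup>2 = (t * norm y)\<^sup>2 - (norm (T y))\<^sup>2"
    unfolding cinner_self using of_real_eq_iff by blast
  moreover have "(t * norm y)\<^sup>2 \<le> (norm (T y))\<^sup>2" using le t by (intro power_mono) auto
  ultimately have "(norm w)\<^sup>2 \<le> 0" by simp
  then have w0: "w = 0" by simp
  have "cinner y b = 0" if b: "b \<in> B" "\<mu> b \<noteq> t" for b
  proof (cases "\<mu> b \<le> t")
    case True
    have "(\<mu> b)\<^sup>2 < t\<^sup>2" using True b \<mu>_nonneg[OF b(1)] by (intro power_strict_mono) auto
    then have "g b \<noteq> 0" using True by (simp add: g_def)
    moreover have "g b * cinner y b = 0" using cinner_diag[OF sym b(1), of y] w0 by (simp add: w_def)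
    ultimately show ?thesis by simp
  qed (use y b in \<open>auto simp: V_def\<close>)
  then show ?thesis by (auto simp: V_def)
qed

text \<open>An injective linear map of a finite-dimensional space into itself is onto;
  \<open>\<beta> < t\<close> supplies both finite dimension and \<open>t > 0\<close>. The count
  compares \<open>?C\<close> with its image, which is orthonormal after division by
  \<open>t\<close>.\<close>

lemma T_surj_eigenspace:
  assumes t: "\<beta> < t" and inv: "\<And>x. x \<in> V {b. \<mu> b = t} \<Longrightarrow> T x \<in> V {b. \<mu> b = t}"
    and z: "z \<in> V {b. \<mu> b = t}"
  obtains x where "x \<in> V {b. \<mu> b = t}" "T x = z"
proof -
  let ?E = "V {b. \<mu> b = t}" and ?C = "B \<inter> {b. \<mu> b = t}"
  have t0: "t > 0" using t \<beta>_nonneg by simp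
  note E = closed_csubspaceD[OF closed_csubspace_V[of "{b. \<mu> b = t}"]]
  have fin: "finite ?C"
    by (rule finite_subset[OF _ finite_above]) (use t in auto)
  define u where "u b = (1 / t) *\<^sub>R T b" for b
  have uE: "u b \<in> ?E" if "b \<in> ?C" for b
    using that unfolding u_def by (intro E(7) inv B_in_V) auto
  have uu: "cinner (u b) (u c) = (if b = c then 1 else 0)" if "b \<in> ?C" "c \<in> ?C" for b c
    using that t0 T_cinner_eigen[of b t c] B_in_V[of b "{b. \<mu> b = t}"]
    by (auto simp: u_def cinner_simps cinner_B power2_eq_square)
  have on: "orthonormal (u ` ?C)"
  proof -
    have "norm (u b) = 1" if "b \<in> ?C" for b
    proof -
      have "(norm (u b))\<^sup>2 = 1\<^sup>2"
        using cinner_self_real(2)[of "u b"] uu[OF that that] by simp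
      then show ?thesis by (rule power2_eq_imp_eq) simp_all
    qed
    moreover have "cinner (u b) (u c) = 0" if "b \<in> ?C" "c \<in> ?C" "u b \<noteq> u c" for b c
      using uu[OF that(1,2)] that(3) by (cases "b = c") auto
    ultimately show ?thesis unfolding orthonormal_def by blast
  qed
  have inj: "inj_on u ?C"
    by (rule inj_onI) (metis uu zero_neq_one)
  have "z \<in> complex_vector.span (u ` ?C)"
  proof (rule ccontr)
    assume nz: "z \<notin> complex_vector.span (u ` ?C)"
    then have "complex_vector.independent (insert z (u ` ?C))"
      by (intro complex_vector.independent_insertI orthonormal_independent on)
    moreover have "insert z (u ` ?C) \<subseteq> complex_vector.span ?C"
      using V_subset_span[OF fin] uE z by blast
    ultimately have "card (insert z (u ` ?C)) \<le> card ?C"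
      using complex_vector.independent_span_bound[OF fin] by blast
    moreover have "z \<notin> u ` ?C" using nz complex_vector.span_base[of z "u ` ?C"] by blast
    ultimately show False using fin card_image[OF inj] by simp
  qed
  also have "complex_vector.span (u ` ?C) \<subseteq> T ` ?E"
  proof (rule complex_vector.span_minimal)
    show "u ` ?C \<subseteq> T ` ?E"
    proof
      fix y assume "y \<in> u ` ?C"
      then obtain b where b: "b \<in> ?C" "y = u b" by blast
      have "(1 / t) *\<^sub>R b \<in> ?E" using b by (intro E(7) B_in_V) auto
      moreover have "y = T ((1 / t) *\<^sub>R b)" by (simp add: b u_def T.scaleR)
      ultimately show "y \<in> T ` ?E" by blast
    qed
    show "complex_vector.subspace (T ` ?E)"
    proof (rule complex_vector.subspaceI)
      show "0 \<in> T ` ?E" using E(3) T.zero by (metis imageI)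
      show "x + y \<in> T ` ?E" if "x \<in> T ` ?E" "y \<in> T ` ?E" for x y
        using that E(4) by (auto simp: T.add[symmetric])
      show "c *\<^sub>C x \<in> T ` ?E" if "x \<in> T ` ?E" for c x
        using that E(6) bounded_opsD(3)[OF T, symmetric] by auto
    qed
  qed
  finally show ?thesis using that by blast
qed

text \<open>Writing \<open>z\<close> as \<open>T x\<close> inside the eigenspace turns
  \<open>adj T z\<close> into \<open>adj T (T x)\<close>, a multiple of \<open>x\<close>. The
  eigenspace therefore reduces \<open>T\<close>.\<close>

lemma adj_T_eigenspace:
  assumes t: "\<beta> < t" and inv: "\<And>x. x \<in> V {b. \<mu> b = t} \<Longrightarrow> T x \<in> V {b. \<mu> b = t}"
    and z: "z \<in> V {b. \<mu> b = t}"
  shows "adj T z \<in> V {b. \<mu> b = t}" "T (adj T z) = complex_of_real (t\<^sup>2) *\<^sub>C z"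
proof -
  obtain x where x: "x \<in> V {b. \<mu> b = t}" "T x = z"
    by (rule T_surj_eigenspace[OF assms])
  have "adj T z = complex_of_real (t\<^sup>2) *\<^sub>C x"
    using TT_eigen[OF x(1)] x(2) by simp
  then show "adj T z \<in> V {b. \<mu> b = t}" "T (adj T z) = complex_of_real (t\<^sup>2) *\<^sub>C z"
    using closed_csubspaceD(6)[OF closed_csubspace_V] x bounded_opsD(3)[OF T] by auto
qed

end

locale diagonalized_hyponormal = diagonalized +
  assumes hyponormal: "hyponormal T"
begin

interpretation T: bounded_linear T
  using T by (rule bounded_ops_bounded_linear)

text \<open>Downward induction on \<open>t\<close>: once the eigenspaces above \<open>t\<close> reduce \<open>T\<close>, the vector \<open>T x\<close> lies in
  the spectral subspace up to \<open>t\<close>, and hyponormality forces \<open>T\<close> to stretch it by the maximal factor \<open>t\<close>.\<close>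

lemma T_eigenspace:
  "\<beta> \<le> t \<Longrightarrow> x \<in> V {b. \<mu> b = t} \<Longrightarrow> T x \<in> V {b. \<mu> b = t}"
proof (induction "card {b\<in>B. \<mu> b > t}" arbitrary: t x rule: less_induct)
  case less
  have t0: "0 \<le> t" using less.prems(1) \<beta>_nonneg by simp
  \<comment> \<open>Fewer basis vectors lie above \<open>\<mu> b\<close> than above
    \<open>t\<close>, so the induction hypothesis makes the eigenspace of \<open>\<mu> b\<close>
    invariant; finite dimension then makes it reducing.\<close>
  have adj_above: "adj T b \<in> V {c. \<mu> c = \<mu> b}" if b: "b \<in> B" "\<mu> b > t" for b
  proof (rule adj_T_eigenspace(1))
    have fin: "finite {b\<in>B. \<mu> b > t}"
      by (rule finite_subset[OF _ finite_above]) (use less.prems(1) in auto)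
    have "{c\<in>B. \<mu> c > \<mu> b} \<subset> {b\<in>B. \<mu> b > t}" using b by auto
    then have "card {c\<in>B. \<mu> c > \<mu> b} < card {b\<in>B. \<mu> b > t}"
      by (rule psubset_card_mono[OF fin])
    then show "T y \<in> V {c. \<mu> c = \<mu> b}" if "y \<in> V {c. \<mu> c = \<mu> b}" for y
      using less.hyps[of "\<mu> b" y] that b less.prems(1) by auto
    show "\<beta> < \<mu> b" using b less.prems(1) by simp
    show "b \<in> V {c. \<mu> c = \<mu> b}" using b by (intro B_in_V) auto
  qed
  show ?case
  proof (rule V_maximal_growth[OF _ t0])
    have "cinner (T x) b = 0" if b: "b \<in> B" "\<mu> b > t" for b
      unfolding adj_spec[OF T] using b by (intro V_cinner[OF less.prems(2) adj_above]) auto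
    then show "T x \<in> V {b. \<mu> b \<le> t}" by (auto simp: V_def)
    have "t * norm (T x) = norm (adj T (T x))"
      using TT_eigen[OF less.prems(2)] norm_T_eigen[OF less.prems(2) t0] t0
      by (simp add: power2_eq_square norm_mult)
    also have "\<dots> \<le> norm (T (T x))"
      by (rule hyponormal_norm_le[OF T hyponormal])
    finally show "t * norm (T x) \<le> norm (T (T x))" .
  qed
qed

lemma adj_T:
  assumes t: "\<beta> < t" and z: "z \<in> V {b. \<mu> b = t}"
  shows "adj T z \<in> V {b. \<mu> b = t}" "T (adj T z) = complex_of_real (t\<^sup>2) *\<^sub>C z"
  using adj_T_eigenspace[OF t T_eigenspace[OF less_imp_le[OF t]] z] by simp_all

lemma T_upper: 
  assumes x: "x \<in> V {b. \<mu> b > \<beta>}" shows "T x \<in> V {b. \<mu> b > \<beta>}"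
proof (rule closed_csubspace_has_sum[OF closed_csubspace_V])
  show "((\<lambda>b. T (cinner x b *\<^sub>C b)) has_sum T x) (B \<inter> {b. \<mu> b > \<beta>})"
    by (rule has_sum_bounded_linear[OF T.bounded_linear_axioms V_expansion[OF x]])
  fix b assume b: "b \<in> B \<inter> {b. \<mu> b > \<beta>}"
  then have "T b \<in> V {c. \<mu> c = \<mu> b}" by (intro T_eigenspace B_in_V) auto
  also have "\<dots> \<subseteq> V {b. \<mu> b > \<beta>}" using b by (intro V_mono) auto
  finally show "T (cinner x b *\<^sub>C b) \<in> V {b. \<mu> b > \<beta>}"
    unfolding bounded_opsD(3)[OF T UNIV_I] by (rule closed_csubspaceD(6)[OF closed_csubspace_V])
qed

text \<open>\<open>adj T\<close> keeps every eigenspace above \<open>\<beta>\<close>, so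
  \<open>T\<close> keeps their common orthogonal complement. Together with \<open>T_upper\<close>
  this yields the zeros in the first row and column of the matrix.\<close>

lemma T_lower: 
  assumes x: "x \<in> V {b. \<mu> b \<le> \<beta>}" shows "T x \<in> V {b. \<mu> b \<le> \<beta>}"
proof -
  have "cinner (T x) b = 0" if b: "b \<in> B" "\<mu> b > \<beta>" for b
    unfolding adj_spec[OF T] using b B_in_V[of b "{c. \<mu> c = \<mu> b}"]
    by (intro V_cinner[OF x adj_T(1)[OF b(2)]]) auto
  then show ?thesis by (auto simp: V_def)
qed

lemma adj_T_upper:
  assumes x: "x \<in> V {b. \<mu> b > \<beta>}" shows "adj T x \<in> V {b. \<mu> b > \<beta>}"
proof -
  have "cinner (adj T x) b = 0" if b: "b \<in> B" "\<mu> b \<le> \<beta>" for b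
  proof -
    have "cinner (T b) x = 0"
      using b by (intro V_cinner[OF T_lower x] B_in_V) auto
    then show ?thesis using adj_spec[OF T] cinner_eq_0_commute by metis
  qed
  then show ?thesis by (auto simp: V_def)
qed

lemma normal_upper:
  assumes x: "x \<in> V {b. \<mu> b > \<beta>}" shows "adj T (T x) = T (adj T x)"
proof (rule vec_eqI)
  fix b assume b: "b \<in> B"
  show "cinner (adj T (T x)) b = cinner (T (adj T x)) b"
  proof (cases "\<mu> b > \<beta>")
    case True
    have "cinner (T (adj T x)) b = cinner (adj T x) (adj T b)"
      by (rule adj_spec[OF T])
    also have "\<dots> = cnj (cinner (adj T b) (adj T x))"
      by (rule cinner_commute)
    also have "cinner (adj T b) (adj T x) = cinner (T (adj T b)) x"
      by (rule adj_spec[OF T, symmetric])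
    also have "cnj \<dots> = cinner x (T (adj T b))"
      by (rule cinner_commute[symmetric])
    also have "\<dots> = complex_of_real ((\<mu> b)\<^sup>2) * cinner x b"
      using adj_T(2)[OF True, of b] b by (simp add: B_in_V cinner_simps)
    finally show ?thesis using cinner_TT[OF b] by simp
  next
    case False
    then show ?thesis
      using V_D[OF adj_T_upper[OF T_upper[OF x]] b] V_D[OF T_upper[OF adj_T_upper[OF x]] b] by simp
  qed
qed

text \<open>Division by \<open>t\<close> makes \<open>T\<close> isometric on the eigenspace; that it
  is also onto comes from finite dimension.\<close>

lemma unitary_eigenspace:
  assumes t: "\<beta> < t" shows "unitary_on (V {b. \<mu> b = t}) (\<lambda>x. (1 / t) *\<^sub>R T x)"
proof -
  let ?E = "V {b. \<mu> b = t}" and ?U = "\<lambda>x. (1 / t) *\<^sub>R T x"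
  have t0: "t \<noteq> 0" using t \<beta>_nonneg by auto
  have "T \<in> bounded_ops ?E ?E"
    using T_eigenspace[of t] t by (intro bounded_ops_mono[OF T]) auto
  then have U: "?U \<in> bounded_ops ?E ?E"
    using closed_csubspace_V by (rule bounded_ops_scaleR)
  have adjU: "adj_on ?E ?E ?U (?U x) = x" if x: "x \<in> ?E" for x
  proof (rule adj_on_eqI[OF closed_csubspace_V bounded_opsD(1)[OF U x] x])
    show "cinner (?U y) (?U x) = cinner y x" if "y \<in> ?E" for y
      using t0 T_cinner_eigen[OF that, of x] by (simp add: cinner_simps power2_eq_square)
  qed
  moreover have "?U (adj_on ?E ?E ?U x) = x" if x: "x \<in> ?E" for x
  proof -
    obtain w where w: "w \<in> ?E" "T w = x"
      using T_surj_eigenspace[OF t T_eigenspace[OF less_imp_le[OF t]] x] by auto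
    have "t *\<^sub>R w \<in> ?E" "?U (t *\<^sub>R w) = x"
      using w t0 closed_csubspaceD(7)[OF closed_csubspace_V] by (auto simp: T.scaleR)
    then show ?thesis using adjU by metis
  qed
  ultimately show ?thesis using U by (auto simp: unitary_on_def)
qed

lemma normal_on_upper: "normal_on (V {b. \<mu> b > \<beta>}) T"
proof -
  let ?H = "V {b. \<mu> b > \<beta>}"
  have "T \<in> bounded_ops ?H ?H"
    using T_upper by (intro bounded_ops_mono[OF T]) auto
  moreover have "adj_on ?H ?H T x = adj T x" if "x \<in> ?H" for x
    using that adj_T_upper by (intro adj_on_eqI closed_csubspace_V adj_spec[OF T])
  ultimately show ?thesis
    using T_upper normal_upper by (simp add: normal_on_def)
qed

end

section \<open>The block decomposition\<close>

text \<open>Indices start at 1, so an infinite set is enumerated with a shift; a finite one gets its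
  cardinality as \<open>m\<close>, possibly 0.\<close>

lemma countable_enumeration:
  fixes S :: "'b set"
  assumes "countable S"
  obtains m :: enat and b :: "nat \<Rightarrow> 'b" where "bij_betw b {j. 1 \<le> j \<and> enat j \<le> m} S"
proof (cases "finite S")
  case True
  then obtain h where "bij_betw h {1..card S} S"
    using ex_bij_betw_nat_finite_1 by blast
  moreover have "{j. 1 \<le> j \<and> enat j \<le> enat (card S)} = {1..card S}" by auto
  ultimately show ?thesis using that[of h "enat (card S)"] by simp
next
  case False
  then have "bij_betw (from_nat_into S) UNIV S"
    using assms bij_betw_from_nat_into by blast
  moreover have "bij_betw (\<lambda>j. j - 1) {j::nat. 1 \<le> j \<and> enat j \<le> \<infinity>} UNIV"
    by (rule bij_betwI[where g=Suc]) auto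
  ultimately have "bij_betw (from_nat_into S \<circ> (\<lambda>j. j - 1)) {j. 1 \<le> j \<and> enat j \<le> \<infinity>} S"
    using bij_betw_trans by blast
  then show ?thesis by (rule that)
qed

section \<open>Spectral values on either side of \<beta>\<close>

context diagonalized
begin

interpretation T: bounded_linear T
  using T by (rule bounded_ops_bounded_linear)

lemma \<mu>_le_onorm: "b \<in> B \<Longrightarrow> \<mu> b \<le> onorm T"
  using onorm[OF T.bounded_linear_axioms, of b] by (simp add: norm_T_B norm_B)

lemma min_modulus_le_\<mu>: "b \<in> B \<Longrightarrow> min_modulus UNIV T \<le> \<mu> b"
  unfolding min_modulus_def using norm_T_B norm_B
  by (intro cInf_lower bdd_belowI[of _ 0]) (auto intro: exI[of _ b])

lemma spectrum_above:
  "{t. \<beta> < t \<and> t \<le> onorm T \<and> complex_of_real t \<in> op_spectrum (abs_op T)} = \<mu> ` (B \<inter> {b. \<mu> b > \<beta>})"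
proof (intro set_eqI iffI)
  fix t assume t: "t \<in> {t. \<beta> < t \<and> t \<le> onorm T \<and> complex_of_real t \<in> op_spectrum (abs_op T)}"
  then obtain b where "b \<in> B" "complex_of_real t = complex_of_real (\<mu> b)"
    using op_spectrum_imp_eigenvalue[of "complex_of_real t"] by auto
  then show "t \<in> \<mu> ` (B \<inter> {b. \<mu> b > \<beta>})" using t by auto
qed (auto intro: op_spectrum_eigenvalue \<mu>_le_onorm)

lemma spectrum_below:
  "{t. min_modulus UNIV T \<le> t \<and> t < \<beta> \<and> complex_of_real t \<in> op_spectrum (abs_op T)} =
    \<mu> ` (B \<inter> {b. \<mu> b < \<beta>})"
proof (intro set_eqI iffI)
  fix t assume t: "t \<in> {t. min_modulus UNIV T \<le> t \<and> t < \<beta> \<and> complex_of_real t \<in> op_spectrum (abs_op T)}"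
  then obtain b where "b \<in> B" "complex_of_real t = complex_of_real (\<mu> b)"
    using op_spectrum_imp_eigenvalue[of "complex_of_real t"] by auto
  then show "t \<in> \<mu> ` (B \<inter> {b. \<mu> b < \<beta>})" using t by auto
qed (auto intro: op_spectrum_eigenvalue min_modulus_le_\<mu>)

text \<open>The part below \<open>\<beta>\<close> is exhausted by the finite sets below
  \<open>\<beta> - 1 / (n + 1)\<close>.\<close>

lemma countable_below: "countable (\<mu> ` (B \<inter> {b. \<mu> b < \<beta>}))"
proof -
  have "B \<inter> {b. \<mu> b < \<beta>} \<subseteq> (\<Union>n. {b\<in>B. \<mu> b < \<beta> - inverse (real (Suc n))})"
  proof
    fix b assume b: "b \<in> B \<inter> {b. \<mu> b < \<beta>}"
    then obtain n where "inverse (real (Suc n)) < \<beta> - \<mu> b"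
      using reals_Archimedean[of "\<beta> - \<mu> b"] by auto
    then have "\<mu> b < \<beta> - inverse (real (Suc n))" by linarith
    then show "b \<in> (\<Union>n. {b\<in>B. \<mu> b < \<beta> - inverse (real (Suc n))})" using b by blast
  qed
  moreover have "countable {b\<in>B. \<mu> b < \<beta> - inverse (real (Suc n))}" for n
    by (intro countable_finite finite_below) simp
  ultimately show ?thesis
    by (meson UNIV_I countable_UN countable_image countable_subset countableI_type)
qed

lemma V_empty: assumes "B \<inter> C = {}" shows "V C = {0}"
proof -
  have "x = 0" if "x \<in> V C" for x using complete V_D[OF that] assms by blast
  then show ?thesis using closed_csubspaceD(3)[OF closed_csubspace_V] by blast
qed

end

section \<open>The blocks of the matrix\<close>

context diagonalized_hyponormal
begin

interpretation T: bounded_linear T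
  using T by (rule bounded_ops_bounded_linear)

definition H0 where "H0 = V {b. \<mu> b > \<beta>}"
definition H1 where "H1 = V {b. \<mu> b = \<beta>}"
definition H2 where "H2 = V {b. \<mu> b < \<beta>}"

text \<open>If \<open>\<beta> = 0\<close>, then \<open>T\<close> vanishes on \<open>H1\<close> and any isometry of \<open>H1\<close> will do.\<close>

definition V1 :: "'a \<Rightarrow> 'a" where "V1 x = (if \<beta> = 0 then x else (1 / \<beta>) *\<^sub>R T x)"
definition A :: "'a \<Rightarrow> 'a" where "A x = proj {b. \<mu> b = \<beta>} (T x)"
definition B2 :: "'a \<Rightarrow> 'a" where "B2 x = proj {b. \<mu> b < \<beta>} (T x)"

lemma closed_H: "closed_csubspace H0" "closed_csubspace H1" "closed_csubspace H2"
  by (simp_all add: H0_def H1_def H2_def closed_csubspace_V)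

lemma orthogonal_H: "corthogonal H0 H1" "corthogonal H0 H2" "corthogonal H1 H2"
  unfolding corthogonal_def H0_def H1_def H2_def by (intro ballI; erule V_cinner, assumption; auto)+

lemma cfinite_dim_H0: "cfinite_dim H0"
  unfolding H0_def cfinite_dim_V_iff
  by (rule finite_subset[OF _ finite_above]) auto

lemma sum_H: "\<exists>x0\<in>H0. \<exists>x1\<in>H1. \<exists>x2\<in>H2. x = x0 + x1 + x2"
proof (intro bexI)
  show "x = proj {b. \<mu> b > \<beta>} x + proj {b. \<mu> b = \<beta>} x + proj {b. \<mu> b < \<beta>} x"
    by (rule vec_eqI) (auto simp: cinner_simps cinner_proj)
qed (simp_all add: H0_def H1_def H2_def proj_in_V)

lemma V1_bounded_ops: "V1 \<in> bounded_ops H1 H1"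
proof (cases "\<beta> = 0")
  case True
  have "id \<in> bounded_ops H1 H1" by (auto simp: bounded_ops_def intro: exI[of _ 1])
  moreover have "V1 = id" unfolding V1_def id_def using True by simp
  ultimately show ?thesis by simp
next
  case False
  have "T \<in> bounded_ops H1 H1"
    using T_eigenspace by (intro bounded_ops_mono[OF T]) (auto simp: H1_def)
  then have "(\<lambda>x. (1 / \<beta>) *\<^sub>R T x) \<in> bounded_ops H1 H1"
    using closed_H(2) by (rule bounded_ops_scaleR)
  then show ?thesis using False by (simp add: V1_def[abs_def])
qed

lemma norm_V1: "x \<in> H1 \<Longrightarrow> norm (V1 x) = norm x"
  using \<beta>_nonneg by (simp add: V1_def norm_T_eigen H1_def)

lemma T_H1: "x \<in> H1 \<Longrightarrow> T x = \<beta> *\<^sub>R V1 x"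
  using norm_T_eigen[of x \<beta>] by (auto simp: V1_def H1_def)

lemma A_bounded_ops: "A \<in> bounded_ops H2 H1"
  using bounded_ops_compose[OF T proj_bounded_ops] unfolding A_def H1_def
  by (rule bounded_ops_mono) (auto intro: proj_in_V)

lemma B2_bounded_ops: "B2 \<in> bounded_ops H2 H2"
  using bounded_ops_compose[OF T proj_bounded_ops] unfolding B2_def H2_def
  by (rule bounded_ops_mono) (auto intro: proj_in_V)

text \<open>By \<open>T_lower\<close> the vector \<open>T x\<close> has no component in
  \<open>H0\<close>, so the two projections exhaust it.\<close>

lemma T_H2: assumes "x \<in> H2" shows "T x = A x + B2 x"
proof (rule vec_eqI)
  have "x \<in> V {b. \<mu> b \<le> \<beta>}" using assms by (auto simp: H2_def V_def)
  then have lower: "T x \<in> V {b. \<mu> b \<le> \<beta>}" by (rule T_lower)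
  fix b assume "b \<in> B"
  then show "cinner (T x) b = cinner (A x + B2 x) b"
    using V_D[OF lower, of b] by (auto simp: A_def B2_def cinner_simps cinner_proj)
qed

lemma T_blocks:
  "x1 \<in> H1 \<Longrightarrow> x2 \<in> H2 \<Longrightarrow> T (x0 + x1 + x2) = T x0 + (\<beta> *\<^sub>R V1 x1 + A x2) + B2 x2"
  by (simp add: T.add T_H1[symmetric] T_H2)

text \<open>For \<open>\<beta> \<noteq> 0\<close>, \<open>V1 y\<close> is a multiple of
  \<open>T y\<close>, and \<open>T\<close> sends the orthogonal vectors \<open>y\<close> and
  \<open>x\<close> to orthogonal vectors because \<open>y\<close> is an eigenvector of the
  modulus.\<close>

lemma adj_V1_A: assumes x: "x \<in> H2" shows "adj_on H1 H1 V1 (A x) = 0"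
proof (rule adj_on_eqI[OF closed_H(2)])
  show "A x \<in> H1" using bounded_opsD(1)[OF A_bounded_ops x] .
  show "0 \<in> H1" using closed_csubspaceD(3)[OF closed_H(2)] .
  fix y assume y: "y \<in> H1"
  have Vy: "V1 y \<in> V {b. \<mu> b = \<beta>}" using bounded_opsD(1)[OF V1_bounded_ops y] by (simp add: H1_def)
  have "cinner (V1 y) (A x) = cinner (V1 y) (T x)"
    unfolding A_def by (rule proj_cinner_right[OF Vy])
  also have "\<dots> = 0"
  proof (cases "\<beta> = 0")
    case True
    \<comment> \<open>The modulus has no negative eigenvalues.\<close>
    have "H2 = {0}" unfolding H2_def by (rule V_empty) (use True \<mu>_nonneg in force)
    then show ?thesis using x by (simp add: T.zero)
  next
    case False
    have "cinner (T y) (T x) = complex_of_real (\<beta>\<^sup>2) * cinner y x"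
      using y by (intro T_cinner_eigen) (simp add: H1_def)
    also have "cinner y x = 0"
      using orthogonal_H(3) x y by (simp add: corthogonal_def)
    finally show ?thesis by (simp add: V1_def False cinner_simps)
  qed
  finally show "cinner (V1 y) (A x) = cinner y 0" by simp
qed

text \<open>The ranges of \<open>A\<close> and \<open>B2\<close> are orthogonal and their sum is
  \<open>T\<close> on \<open>H2\<close>, so the left side is the compression of
  \<open>adj T \<circ> T\<close> to \<open>H2\<close>; that operator is diagonal in the eigenbasis
  and leaves \<open>H2\<close> invariant.\<close>

lemma adj_A_B2:
  assumes x: "x \<in> H2"
  shows "adj_on H2 H1 A (A x) + adj_on H2 H2 B2 (B2 x) = adj T (T x)"
proof -
  note adA = adj_on_spec[OF closed_H(3) A_bounded_ops bounded_opsD(1)[OF A_bounded_ops x]]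
  note adB = adj_on_spec[OF closed_H(3) B2_bounded_ops bounded_opsD(1)[OF B2_bounded_ops x]]
  have "adj T (T x) \<in> H2" using x by (auto simp: H2_def V_def cinner_TT)
  then have w: "adj_on H2 H1 A (A x) + adj_on H2 H2 B2 (B2 x) - adj T (T x) \<in> H2" (is "?w \<in> H2")
    using adA(1) adB(1) closed_csubspaceD(4,5)[OF closed_H(3)] by blast
  have AB: "cinner (A y) (B2 z) = 0" "cinner (B2 y) (A z) = 0" for y z
    unfolding A_def B2_def by (intro V_cinner[OF proj_in_V proj_in_V]; auto)+
  have "cinner y ?w = 0" if y: "y \<in> H2" for y
  proof -
    have "cinner y ?w = cinner (A y) (A x) + cinner (B2 y) (B2 x) - cinner (T y) (T x)"
      using adA(2)[OF y] adB(2)[OF y] adj_spec[OF T, of y "T x"] by (simp add: cinner_simps)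
    then show ?thesis by (simp add: T_H2 x y cinner_simps AB)
  qed
  from this[OF w] show ?thesis by simp
qed

text \<open>The adjoint of \<open>B2\<close> on \<open>H2\<close> is a compression of
  \<open>adj T\<close>, so its value \<open>z\<close> at \<open>x\<close> is no longer than
  \<open>adj T x\<close>; hyponormality bounds that by \<open>norm (T x)\<close>.\<close>

lemma B2_adj_le:
  assumes x: "x \<in> H2"
  shows "cinner (adj T (T x) - B2 (adj_on H2 H2 B2 x)) x \<in> \<real>\<^sub>\<ge>\<^sub>0"
proof -
  define z where "z = adj_on H2 H2 B2 x"
  note ad = adj_on_spec[OF closed_H(3) B2_bounded_ops x, folded z_def]
  have zz: "cinner (B2 z) x = cinner z z" using ad by blast
  have "cinner (B2 z) x = cinner (T z) x"
    unfolding B2_def using x by (intro proj_cinner_left) (simp add: H2_def)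
  then have "complex_of_real ((norm z)\<^sup>2) = cinner z (adj T x)"
    using zz adj_spec[OF T, of z x] by (simp add: cinner_self)
  then have "(norm z)\<^sup>2 = cmod (cinner z (adj T x))"
    by (metis abs_power2 norm_of_real)
  then have "norm z * norm z \<le> norm z * norm (adj T x)"
    using complex_Cauchy_Schwarz[of z "adj T x"] by (simp add: power2_eq_square)
  then have "norm z \<le> norm (adj T x)"
    by (cases "z = 0") simp_all
  also have "\<dots> \<le> norm (T x)" by (rule hyponormal_norm_le[OF T hyponormal])
  finally have "(norm z)\<^sup>2 \<le> (norm (T x))\<^sup>2" by (intro power_mono) auto
  moreover have "cinner (adj T (T x)) x = cinner (T x) (T x)"
    using adj_spec[OF T, of x "T x"] by (metis cinner_commute)
  then have "cinner (adj T (T x) - B2 z) x = complex_of_real ((norm (T x))\<^sup>2 - (norm z)\<^sup>2)"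
    by (simp add: cinner_diff_left zz cinner_self)
  ultimately show ?thesis
    unfolding z_def[symmetric] by (simp only: complex_nonneg_Reals_iff Re_complex_of_real Im_complex_of_real) simp
qed

lemma H1_UNIV:
  assumes "onorm T = \<beta>" "\<beta> = min_modulus UNIV T" shows "H1 = UNIV"
proof -
  have "\<mu> b = \<beta>" if "b \<in> B" for b
    using \<mu>_le_onorm[OF that] min_modulus_le_\<mu>[OF that] assms by simp
  then show ?thesis by (auto simp: H1_def V_def)
qed

lemma H0_trivial: "\<beta> = onorm T \<Longrightarrow> H0 = {0}"
  unfolding H0_def using \<mu>_le_onorm by (intro V_empty) force

lemma H2_trivial: "\<beta> = min_modulus UNIV T \<Longrightarrow> H2 = {0}"
  unfolding H2_def using min_modulus_le_\<mu> by (intro V_empty) force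

lemma finite_eigenvalues_above: "finite (\<mu> ` (B \<inter> {b. \<mu> b > \<beta>}))"
  using cfinite_dim_H0 by (simp add: H0_def cfinite_dim_V_iff)

text \<open>The factors \<open>\<alpha> i\<close> and \<open>1 / \<alpha> i\<close> cancel because
  \<open>\<alpha> i > \<beta> \<ge> 0\<close>, so each block agrees with \<open>T\<close>.\<close>

lemma T_direct_sum:
  assumes \<alpha>: "inj_on \<alpha> I" "\<alpha> ` I = \<mu> ` (B \<inter> {b. \<mu> b > \<beta>})" and x: "x \<in> H0"
  shows "T x = direct_sum_op I (\<lambda>i. abs_eigenspace T (\<alpha> i)) (\<lambda>i x. \<alpha> i *\<^sub>R (1 / \<alpha> i) *\<^sub>R T x) x"
proof (rule sym, rule direct_sum_op_eigenspaces[OF \<alpha>, where S="{\<beta><..}"])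
  show "x \<in> V {b. \<mu> b > \<beta>}" using x by (simp add: H0_def)
  show "T u = \<alpha> i *\<^sub>R (1 / \<alpha> i) *\<^sub>R T u" if i: "i \<in> I" for i u
  proof -
    have "\<alpha> i \<in> \<mu> ` (B \<inter> {b. \<mu> b > \<beta>})" using \<alpha>(2) i by blast
    then have "\<alpha> i > \<beta>" by auto
    then show ?thesis using \<beta>_nonneg by simp
  qed
qed (auto intro: T.bounded_linear_axioms)

lemma TT_direct_sum:
  assumes b: "inj_on b J" "b ` J = \<mu> ` (B \<inter> {b. \<mu> b < \<beta>})" and x: "x \<in> H2"
  shows "direct_sum_op J (\<lambda>j. abs_eigenspace T (b j)) (\<lambda>j x. (b j)\<^sup>2 *\<^sub>R x) x = adj T (T x)"
proof -
  have "direct_sum_op J (\<lambda>j. abs_eigenspace T (b j)) (\<lambda>j x. (b j)\<^sup>2 *\<^sub>R x) x = P (P x)"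
  proof (rule direct_sum_op_eigenspaces[OF b, where S="{..<\<beta>}"])
    show "x \<in> V {b. \<mu> b < \<beta>}" using x by (simp add: H2_def)
    show "bounded_linear (\<lambda>x. P (P x))"
      by (rule bounded_ops_bounded_linear[OF bounded_ops_compose[OF P_bounded_ops P_bounded_ops]])
    show "P (P u) = (b j)\<^sup>2 *\<^sub>R u" if "u \<in> abs_eigenspace T (b j)" for j u
      using that unfolding abs_eigenspace_eq P_P by (simp add: TT_eigen del: of_real_power) (simp only: scaleC_of_real)
  qed auto
  then show ?thesis by (simp add: P_P)
qed

end

theorem theorem4p2:
  fixes T :: "'a::chilbert_space \<Rightarrow> 'a"
  assumes "\<not> cfinite_dim (UNIV :: 'a set)"
    and "AM_op T" and "hyponormal T"
  shows "\<exists>(H0 :: 'a set) H1 H2 (V0 :: 'a \<Rightarrow> 'a) V1 A B (\<beta> :: real)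
      (n :: nat) (\<alpha> :: nat \<Rightarrow> real) (U :: nat \<Rightarrow> 'a \<Rightarrow> 'a) (m :: enat) (b :: nat \<Rightarrow> real).
    let J = {j. 1 \<le> j \<and> enat j \<le> m};
        D = direct_sum_op J (\<lambda>j. abs_eigenspace T (b j)) (\<lambda>j x. (b j)\<^sup>2 *\<^sub>R x)
    in
      closed_csubspace H0 \<and> closed_csubspace H1 \<and> closed_csubspace H2 \<and> cfinite_dim H0 \<and>
      corthogonal H0 H1 \<and> corthogonal H0 H2 \<and> corthogonal H1 H2 \<and>
      (\<forall>x. \<exists>x0\<in>H0. \<exists>x1\<in>H1. \<exists>x2\<in>H2. x = x0 + x1 + x2) \<and>
      V0 \<in> bounded_ops H0 H0 \<and> V1 \<in> bounded_ops H1 H1 \<and>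
      A \<in> bounded_ops H2 H1 \<and> B \<in> bounded_ops H2 H2 \<and>
      (\<forall>x0\<in>H0. \<forall>x1\<in>H1. \<forall>x2\<in>H2.
         T (x0 + x1 + x2) = V0 x0 + (\<beta> *\<^sub>R V1 x1 + A x2) + B x2) \<and>
      ess_spectrum (abs_op T) = {complex_of_real \<beta>} \<and> \<beta> \<ge> 0 \<and>
      (inj_on \<alpha> {1..n} \<and>
       {t. \<beta> < t \<and> t \<le> onorm T \<and> complex_of_real t \<in> op_spectrum (abs_op T)} = \<alpha> ` {1..n} \<and>
       orthogonal_family {1..n} (\<lambda>i. abs_eigenspace T (\<alpha> i)) \<and>
       H0 = hilbert_sum {1..n} (\<lambda>i. abs_eigenspace T (\<alpha> i)) \<and>
       (\<forall>i\<in>{1..n}. unitary_on (abs_eigenspace T (\<alpha> i)) (U i)) \<and>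
       (\<forall>x\<in>H0. V0 x = direct_sum_op {1..n} (\<lambda>i. abs_eigenspace T (\<alpha> i)) (\<lambda>i x. \<alpha> i *\<^sub>R U i x) x) \<and>
       normal_on H0 V0 \<and> cfinite_dim (V0 ` H0) \<and>
       (\<beta> = onorm T \<longrightarrow> H0 = {0})) \<and>
      ((H1 \<noteq> {0} \<longrightarrow> isometry_on H1 V1) \<and> (H1 = {0} \<longrightarrow> (\<forall>x\<in>H1. V1 x = 0))) \<and>
      (inj_on b J \<and>
       {t. min_modulus UNIV T \<le> t \<and> t < \<beta> \<and> complex_of_real t \<in> op_spectrum (abs_op T)} = b ` J \<and>
       orthogonal_family J (\<lambda>j. abs_eigenspace T (b j)) \<and>
       H2 = hilbert_sum J (\<lambda>j. abs_eigenspace T (b j)) \<and>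
       (\<forall>x\<in>H2. adj_on H1 H1 V1 (A x) = 0) \<and>
       (\<forall>x\<in>H2. adj_on H2 H1 A (A x) + adj_on H2 H2 B (B x) = D x) \<and>
       op_le_on H2 (\<lambda>x. B (adj_on H2 H2 B x)) D \<and>
       (\<beta> = min_modulus UNIV T \<longrightarrow> H2 = {0})) \<and>
      (onorm T = \<beta> \<and> \<beta> = min_modulus UNIV T \<longrightarrow>
         H1 = UNIV \<and> (\<forall>x. T x = onorm T *\<^sub>R V1 x))"
proof -
  obtain B \<mu> \<beta> where "diagonalized T B \<mu> \<beta>"
    by (rule AM_diagonalized[OF assms(2,1)])
  then interpret diagonalized T B \<mu> \<beta> .
  interpret diagonalized_hyponormal T B \<mu> \<beta>
    by standard (rule assms(3))
  obtain \<alpha> where "bij_betw \<alpha> {1..card (\<mu> ` (B \<inter> {b. \<mu> b > \<beta>}))} (\<mu> ` (B \<inter> {b. \<mu> b > \<beta>}))"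
    using ex_bij_betw_nat_finite_1[OF finite_eigenvalues_above] by blast
  then obtain n :: nat where \<alpha>: "inj_on \<alpha> {1..n}" "\<alpha> ` {1..n} = \<mu> ` (B \<inter> {b. \<mu> b > \<beta>})"
    unfolding bij_betw_def by blast
  obtain m :: enat and b where "bij_betw b {j. 1 \<le> j \<and> enat j \<le> m} (\<mu> ` (B \<inter> {b. \<mu> b < \<beta>}))"
    by (rule countable_enumeration[OF countable_below])
  then have b: "inj_on b {j. 1 \<le> j \<and> enat j \<le> m}"
    "b ` {j. 1 \<le> j \<and> enat j \<le> m} = \<mu> ` (B \<inter> {b. \<mu> b < \<beta>})"
    unfolding bij_betw_def by blast+
  have \<alpha>_gt: "\<beta> < \<alpha> i" if "i \<in> {1..n}" for i
  proof -
    have "\<alpha> i \<in> \<mu> ` (B \<inter> {b. \<mu> b > \<beta>})" using \<alpha>(2) that by blast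
    then show ?thesis by auto
  qed
  have H0: "H0 = hilbert_sum {1..n} (\<lambda>i. abs_eigenspace T (\<alpha> i))"
    unfolding H0_def by (rule hilbert_sum_eigenspaces[OF \<alpha>, where S="{\<beta><..}", symmetric]) auto
  have H2: "H2 = hilbert_sum {j. 1 \<le> j \<and> enat j \<le> m} (\<lambda>j. abs_eigenspace T (b j))"
    unfolding H2_def by (rule hilbert_sum_eigenspaces[OF b, where S="{..<\<beta>}", symmetric]) auto
  show ?thesis
    unfolding Let_def
  \<comment> \<open>Operators between subspaces matter only on their domain, so \<open>T\<close>
    itself serves as \<open>V0\<close> and \<open>T\<close> divided by \<open>\<alpha> i\<close> as
    \<open>U i\<close>.\<close>
  proof (rule exI[of _ H0], rule exI[of _ H1], rule exI[of _ H2], rule exI[of _ T], rule exI[of _ V1],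
      rule exI[of _ A], rule exI[of _ B2], rule exI[of _ \<beta>], rule exI[of _ n], rule exI[of _ \<alpha>],
      rule exI[of _ "\<lambda>i x. (1 / \<alpha> i) *\<^sub>R T x"], rule exI[of _ m], rule exI[of _ b], intro
      conjI ballI allI impI closed_H orthogonal_H cfinite_dim_H0 sum_H V1_bounded_ops A_bounded_ops
      B2_bounded_ops T_blocks ess_spectrum_eq \<beta>_nonneg \<alpha>(1) b(1) H0 H2 H0_trivial H2_trivial
      orthogonal_family_eigenspaces adj_V1_A)
    show "T \<in> bounded_ops H0 H0"
      using T_upper by (intro bounded_ops_mono[OF T]) (auto simp: H0_def)
    show "{t. \<beta> < t \<and> t \<le> onorm T \<and> complex_of_real t \<in> op_spectrum (abs_op T)} = \<alpha> ` {1..n}"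
      by (simp only: spectrum_above \<alpha>(2))
    show "unitary_on (abs_eigenspace T (\<alpha> i)) (\<lambda>x. (1 / \<alpha> i) *\<^sub>R T x)" if "i \<in> {1..n}" for i
      unfolding abs_eigenspace_eq by (rule unitary_eigenspace[OF \<alpha>_gt[OF that]])
    show "T x = direct_sum_op {1..n} (\<lambda>i. abs_eigenspace T (\<alpha> i)) (\<lambda>i x. \<alpha> i *\<^sub>R (1 / \<alpha> i) *\<^sub>R T x) x"
      if "x \<in> H0" for x
      by (rule T_direct_sum[OF \<alpha> that])
    show "normal_on H0 T" unfolding H0_def by (rule normal_on_upper)
    show "cfinite_dim (T ` H0)"
      using T_upper by (intro cfinite_dim_subset[OF cfinite_dim_H0]) (auto simp: H0_def)
    show "isometry_on H1 V1"
      by (simp add: isometry_on_def V1_bounded_ops norm_V1)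
    \<comment> \<open>An isometry on the zero space vanishes there, so one \<open>V1\<close> covers
      both cases.\<close>
    show "V1 x = 0" if "H1 = {0}" "x \<in> H1" for x
      using norm_V1[OF that(2)] that by simp
    show "{t. min_modulus UNIV T \<le> t \<and> t < \<beta> \<and> complex_of_real t \<in> op_spectrum (abs_op T)} =
        b ` {j. 1 \<le> j \<and> enat j \<le> m}"
      by (simp only: spectrum_below b(2))
    show "adj_on H2 H1 A (A x) + adj_on H2 H2 B2 (B2 x) =
        direct_sum_op {j. 1 \<le> j \<and> enat j \<le> m} (\<lambda>j. abs_eigenspace T (b j)) (\<lambda>j x. (b j)\<^sup>2 *\<^sub>R x) x"
      if "x \<in> H2" for x
      by (simp only: TT_direct_sum[OF b that] adj_A_B2[OF that])
    show "op_le_on H2 (\<lambda>x. B2 (adj_on H2 H2 B2 x))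
        (direct_sum_op {j. 1 \<le> j \<and> enat j \<le> m} (\<lambda>j. abs_eigenspace T (b j)) (\<lambda>j x. (b j)\<^sup>2 *\<^sub>R x))"
      unfolding op_le_on_def positive_on_def
    proof
      fix x assume "x \<in> H2"
      then show "cinner (direct_sum_op {j. 1 \<le> j \<and> enat j \<le> m} (\<lambda>j. abs_eigenspace T (b j))
          (\<lambda>j x. (b j)\<^sup>2 *\<^sub>R x) x - B2 (adj_on H2 H2 B2 x)) x \<in> \<real>\<^sub>\<ge>\<^sub>0"
        by (simp only: TT_direct_sum[OF b] B2_adj_le)
    qed
    show "H1 = UNIV" if "onorm T = \<beta> \<and> \<beta> = min_modulus UNIV T"
      using that H1_UNIV by blast
    show "T x = onorm T *\<^sub>R V1 x" if "onorm T = \<beta> \<and> \<beta> = min_modulus UNIV T" for x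
      using that H1_UNIV T_H1[of x] by (metis UNIV_I)
  qed
qed

end
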